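(* For every integer $k\ge 2$, the set of unordered $k$-tuples $\{h_1,\dots,h_k\}\in X_k$ such that $\langle h_1,\dots,h_k\rangle = F$ has positive asymptotic density in $X_k$ with respect to the sum stratification, and also with respect to the max stratification. That is, in both models a random $k$-generated subgroup of $F$ equals $F$ with positive asymptotic probability.
   Context: Thompson's group $F$ is the group of piecewise linear homeomorphisms of $[0,1]$ with finitely many breakpoints, all at dyadic rationals, and all slopes integer powers of $2$. Every element of $F$ is represented by a unique reduced tree-diagram $(T_+,T_-)$: a pair of finite full binary trees with the same number of carets and no common carets. The size $|g|$ of $g\in F$ is the number of carets in each tree of its reduced tree-diagram. Let $X$ denote the set of reduced tree-diagrams, identified with $F$. Let $X_k$ denote the set of unordered $k$-tuples, i.e. multisets of size $k$, of elements of $X$. Sum stratification: $\|\{h_1,\dots,h_k\}\|_{\mathrm{sum}}=\sum_i |h_i|$, and $\mathrm{Sph}^{sum}_k(n)$ is the set of tuples of sum-size $n$. Max stratification: $\|\{h_1,\dots,h_k\}\|_{\max}=\max_i|h_i|$, and $\mathrm{Sph}^{max}_k(n)$ is defined analogously. A subset $T\subseteq X_k$ has positive asymptotic density with respect to a stratification with spheres $\mathrm{Sph}_k(n)$ if $\liminf_{n\to\infty} |T\cap \mathrm{Sph}_k(n)|/|\mathrm{Sph}_k(n)|>0$. *)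

theory Defs
  imports Complex_Main "HOL-Library.Multiset" "HOL-Library.Extended_Real" "HOL-Library.Liminf_Limsup"
begin

definition dyadic :: "real \<Rightarrow> bool" where
  "dyadic x \<longleftrightarrow> (\<exists>(a::int) (m::nat). x = real_of_int a / 2 ^ m)"

text \<open>Elements of F are extended by the identity outside [0,1], so that F is a group
  under composition of functions real => real.  A function is in F iff it fixes 0 and 1
  and is piecewise linear on a finite dyadic subdivision 0 = x_0 < ... < x_n = 1 with
  slopes integer powers of 2 (pieces are glued continuously, so it is an increasing
  homeomorphism of [0,1]).\<close>

definition thompsonF :: "(real \<Rightarrow> real) set" where
  "thompsonF = {f. (\<forall>x. x < 0 \<or> 1 < x \<longrightarrow> f x = x) \<and> f 0 = 0 \<and> f 1 = 1 \<and>
     (\<exists>(xs :: real list) (ks :: int list).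
        length xs = length ks + 1 \<and> xs ! 0 = 0 \<and> last xs = 1 \<and>
        sorted_wrt (<) xs \<and> (\<forall>x\<in>set xs. dyadic x) \<and>
        (\<forall>i < length ks. \<forall>x. xs ! i \<le> x \<and> x \<le> xs ! (i+1) \<longrightarrow>
            f x = f (xs ! i) + (2::real) powi (ks ! i) * (x - xs ! i)))}"

inductive_set gen_subgroup :: "(real \<Rightarrow> real) set \<Rightarrow> (real \<Rightarrow> real) set"
  for S :: "(real \<Rightarrow> real) set" where
  gen_id: "id \<in> gen_subgroup S"
| gen_mult: "g \<in> gen_subgroup S \<Longrightarrow> f \<in> S \<Longrightarrow> f \<circ> g \<in> gen_subgroup S"
| gen_inv: "g \<in> gen_subgroup S \<Longrightarrow> f \<in> S \<Longrightarrow> inv f \<circ> g \<in> gen_subgroup S"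

datatype tree = Leaf | Caret tree tree

fun carets :: "tree \<Rightarrow> nat" where
  "carets Leaf = 0"
| "carets (Caret l r) = Suc (carets l + carets r)"

fun nleaves :: "tree \<Rightarrow> nat" where
  "nleaves Leaf = 1"
| "nleaves (Caret l r) = nleaves l + nleaves r"

fun intervals :: "tree \<Rightarrow> real \<Rightarrow> real \<Rightarrow> (real \<times> real) list" where
  "intervals Leaf a b = [(a, b)]"
| "intervals (Caret l r) a b =
     intervals l a ((a + b) / 2) @ intervals r ((a + b) / 2) b"

text \<open>Exposed carets: leaf positions i such that leaves i and i+1 are the two children
  of one caret (offset = index of the first leaf of the subtree).\<close>
fun exposed :: "tree \<Rightarrow> nat \<Rightarrow> nat set" where
  "exposed Leaf n = {}"
| "exposed (Caret l r) n =
     (if l = Leaf \<and> r = Leaf then {n} else exposed l n \<union> exposed r (n + nleaves l))"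

type_synonym diagram = "tree \<times> tree"

definition reduced :: "diagram \<Rightarrow> bool" where
  "reduced d \<longleftrightarrow> carets (fst d) = carets (snd d) \<and>
     exposed (fst d) 0 \<inter> exposed (snd d) 0 = {}"

definition Xdiag :: "diagram set" where
  "Xdiag = {d. reduced d}"

definition dsize :: "diagram \<Rightarrow> nat" where
  "dsize d = carets (fst d)"

fun apply_pieces :: "((real \<times> real) \<times> (real \<times> real)) list \<Rightarrow> real \<Rightarrow> real" where
  "apply_pieces [] x = x"
| "apply_pieces (((a, b), (c, d)) # ps) x =
     (if a \<le> x \<and> x \<le> b then c + (d - c) / (b - a) * (x - a) else apply_pieces ps x)"

definition diagram_fun :: "diagram \<Rightarrow> real \<Rightarrow> real" where
  "diagram_fun d = apply_pieces (zip (intervals (fst d) 0 1) (intervals (snd d) 0 1))"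

definition Xk :: "nat \<Rightarrow> diagram multiset set" where
  "Xk k = {M. size M = k \<and> set_mset M \<subseteq> Xdiag}"

definition sum_norm :: "diagram multiset \<Rightarrow> nat" where
  "sum_norm M = sum_mset (image_mset dsize M)"

definition max_norm :: "diagram multiset \<Rightarrow> nat" where
  "max_norm M = Max (dsize ` set_mset M)"

definition sphere :: "(diagram multiset \<Rightarrow> nat) \<Rightarrow> nat \<Rightarrow> nat \<Rightarrow> diagram multiset set" where
  "sphere nrm k n = {M \<in> Xk k. nrm M = n}"

definition positive_density ::
  "(diagram multiset \<Rightarrow> nat) \<Rightarrow> nat \<Rightarrow> diagram multiset set \<Rightarrow> bool" where
  "positive_density nrm k T \<longleftrightarrow>
     liminf (\<lambda>n. ereal (real (card (T \<inter> sphere nrm k n)) / real (card (sphere nrm k n)))) > 0"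

definition generating_tuples :: "nat \<Rightarrow> diagram multiset set" where
  "generating_tuples k =
     {M \<in> Xk k. gen_subgroup (diagram_fun ` set_mset M) = thompsonF}"

end

theory Submission
  imports Defs "HOL-Combinatorics.Multiset_Permutations"
begin

text \<open>Let f be any element of F which is the identity on [5/8, 1], equals 2x near 0 and maps
  J = [1/2, 5/8] affinely onto its right half, and let g be any element which is the identity on
  [0, 1/2], doubles J at its left endpoint and has slope 1/2 near 1.  On the remaining intervals
  f and g are arbitrary.  Nevertheless the product of the inverse of g, f, g and the inverse of f
  is completely determined: it is the standard generator of the copy of F on J.  Conjugation by f
  or by the inverse of g copies an element supported on J to the right or to the left half of J,
  so the generated group H contains every element supported on J (associativity moves connect any
  two trees with the same number of carets).  Conjugating by powers of f and g, H contains every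
  element of F with support inside the open interval (0, 1), and the slopes of f at 0 and of g at
  1 then give H = F.

  Hence any two reduced diagrams can be hidden inside a generating pair at the cost of a bounded
  number of carets, and it remains to see that the number r(n) of reduced diagrams of size n
  satisfies r(n + 1) \<le> K r(n).  This follows by deleting the i-th leaf from both trees and double
  counting over i: on average there are boundedly many ways to insert the leaf again, and
  common exposed carets created by the deletion lie next to position i, where they can be removed
  by a rotation.\<close>

subsection \<open>Exposed carets and deletion of a leaf\<close>

text \<open>The commutator ignores the free parts because each of them is met only where the other
  map is the identity. Up to 9/16 the inverse of f leads into the region up to 1/2, where g fixes
  every point, so f cancels against its inverse; from 5/8 on, g takes values of at least 3/4, where
  f fixes every point, so g cancels. What remains is the prescribed action on J.

  For the counting, a one-sided ratio bound suffices, so no asymptotic formula enters. The obstacle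
  is that leaf deletion is not boundedly many to one: a leaf can be put back at any height along a
  path of left edges or of right edges. The total length of these paths is at most twice the number
  of carets, so for at least half of the leaves the height is below 8 in both trees. This gives K =
  4096: a factor 2 for the half, 16 possible labels in each of the two trees, and 8 for repairing
  the three positions where deletion can create a common exposed caret.\<close>

lemma nleaves_carets: "nleaves t = Suc (carets t)"
  by (induction t) auto

lemma nleaves_pos [simp]: "0 < nleaves t"
  by (simp add: nleaves_carets)

lemma nleaves_neq_0 [simp]: "nleaves t \<noteq> 0"
  by (simp add: nleaves_carets)

lemma nleaves_eq_1: "nleaves t = Suc 0 \<longleftrightarrow> t = Leaf"
  by (cases t) (auto simp: nleaves_carets)

lemma finite_carets: "finite {t. carets t = n}"
proof (induction n rule: less_induct)
  case (less n)
  let ?A = "\<Union>i\<in>{..<n}. {t. carets t = i}"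
  have "{t. carets t = n} \<subseteq> insert Leaf ((\<lambda>(l, r). Caret l r) ` (?A \<times> ?A))"
  proof
    fix t assume t: "t \<in> {t. carets t = n}"
    show "t \<in> insert Leaf ((\<lambda>(l, r). Caret l r) ` (?A \<times> ?A))"
      using t by (cases t) auto
  qed
  moreover have "finite ?A" using less by auto
  ultimately show ?case by (meson finite_SigmaI finite_imageI finite_insert finite_subset)
qed

lemma exposed_shift: "exposed t (n + m) = (\<lambda>j. j + m) ` exposed t n"
proof (induction t arbitrary: n)
  case (Caret l r)
  have "exposed r (n + m + nleaves l) = (\<lambda>j. j + m) ` exposed r (n + nleaves l)"
    using Caret.IH(2)[of "n + nleaves l"] by (simp add: ac_simps)
  then show ?case using Caret.IH(1)[of n] by (auto simp: image_Un)
qed auto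

lemma exposed_Suc: "Suc j \<in> exposed t (Suc n) \<longleftrightarrow> j \<in> exposed t n"
  using exposed_shift[of t n 1] by auto

lemma mem_exposed_shift: "j \<in> exposed t (n + m) \<longleftrightarrow> m \<le> j \<and> j - m \<in> exposed t n"
  unfolding exposed_shift by (auto simp: image_iff) (metis le_add_diff_inverse2)

lemma exposed_bounds: "j \<in> exposed t n \<Longrightarrow> n \<le> j \<and> j + 1 < n + nleaves t"
proof (induction t arbitrary: n)
  case (Caret l r)
  show ?case using Caret.prems Caret.IH(1)[of n] Caret.IH(2)[of "n + nleaves l"]
    by (auto split: if_splits)
qed auto

text \<open>Distinct exposed carets have no leaf in common. This protects the rotations below: if
  position \<open>p\<close> belongs to the exposed set of one tree, then \<open>p - 1\<close> and
  \<open>p + 1\<close> do not, so a caret that moves there in the other tree causes no new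
  collision.\<close>

lemma exposed_separated: "j \<in> exposed t n \<Longrightarrow> Suc j \<notin> exposed t n"
proof (induction t arbitrary: n)
  case (Caret l r)
  show ?case
    using Caret.prems Caret.IH(1)[of n] Caret.IH(2)[of "n + nleaves l"]
      exposed_bounds[of j l n] exposed_bounds[of "Suc j" l n]
      exposed_bounds[of j r "n + nleaves l"] exposed_bounds[of "Suc j" r "n + nleaves l"]
    by (auto split: if_splits)
qed auto

lemma leaf_cases [consumes 1, case_names leftLeaf left rightLeaf right]:
  assumes "i < nleaves (Caret l r)"
  obtains "l = Leaf" "i = 0" | "l \<noteq> Leaf" "i < nleaves l"
    | "r = Leaf" "i = nleaves l" | "r \<noteq> Leaf" "nleaves l \<le> i"
  using assms by (cases "i < nleaves l"; cases "l = Leaf"; cases "r = Leaf") auto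

fun del_leaf :: "nat \<Rightarrow> tree \<Rightarrow> tree" where
  "del_leaf i Leaf = Leaf"
| "del_leaf i (Caret l r) =
     (if i < nleaves l then (if l = Leaf then r else Caret (del_leaf i l) r)
      else (if r = Leaf then l else Caret l (del_leaf (i - nleaves l) r)))"

lemma carets_del_leaf: "i < nleaves t \<Longrightarrow> carets (del_leaf i t) = carets t - 1"
proof (induction t arbitrary: i)
  case (Caret l r)
  have "0 < carets t" if "t \<noteq> Leaf" for t using that by (cases t) auto
  then show ?case using Caret by (auto simp: Suc_le_eq)
qed auto

text \<open>A new exposed caret arises only when the sibling of leaf \<open>i\<close> is itself a
  leaf and moves up next to another leaf. After renumbering this sibling is leaf
  \<open>i - 1\<close> or \<open>i\<close>, and its new partner may lie on either side, so the caret
  starts at \<open>i - 2\<close>, \<open>i - 1\<close> or \<open>i\<close>. All other exposed carets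
  are old ones, shifted by one behind \<open>i\<close>.\<close>

lemma exposed_del_leaf:
  assumes "i < nleaves t" "j \<in> exposed (del_leaf i t) n"
  shows "(n + i \<le> j + 2 \<and> j \<le> n + i) \<or> (j < n + i \<and> j \<in> exposed t n) \<or>
         (n + i < j \<and> Suc j \<in> exposed t n)"
  using assms
proof (induction t arbitrary: i n)
  case Leaf
  then show ?case by simp
next
  case (Caret l r)
  show ?case
    using Caret.prems(1)
  proof (cases rule: leaf_cases)
    case leftLeaf
    then have j: "j \<in> exposed r n" using Caret.prems by simp
    then have "r \<noteq> Leaf" by auto
    then have "Suc j \<in> exposed (Caret l r) n" using j leftLeaf by (auto simp: exposed_Suc)
    then show ?thesis using exposed_bounds[OF j] leftLeaf by auto
  next
    case left
    have nl: "nleaves (del_leaf i l) = nleaves l - 1" "1 < nleaves l"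
      using left carets_del_leaf[of i l] by (cases l; simp add: nleaves_carets)+
    show ?thesis
    proof (cases "del_leaf i l = Leaf \<and> r = Leaf")
      case True
      then show ?thesis using Caret.prems left nl by auto
    next
      case False
      then have "j \<in> exposed (del_leaf i l) n \<or> j \<in> exposed r (n + (nleaves l - 1))"
        using Caret.prems left nl by (auto split: if_splits)
      then show ?thesis
      proof
        assume "j \<in> exposed (del_leaf i l) n"
        then show ?thesis using Caret.IH(1)[of i n] left by auto
      next
        assume j: "j \<in> exposed r (n + (nleaves l - 1))"
        then have "Suc j \<in> exposed r (n + nleaves l)"
          using nl exposed_Suc[of j r "n + (nleaves l - 1)"] by simp
        then show ?thesis using left exposed_bounds[OF j] by auto
      qed
    qed
  next
    case rightLeaf
    then have j: "j \<in> exposed l n" using Caret.prems by simp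
    then have "l \<noteq> Leaf" by auto
    then show ?thesis using exposed_bounds[OF j] rightLeaf j by auto
  next
    case right
    define i' where "i' = i - nleaves l"
    have i: "i = nleaves l + i'" using right by (simp add: i'_def)
    have i'r: "i' < nleaves r" using Caret.prems(1) i by simp
    show ?thesis
    proof (cases "l = Leaf \<and> del_leaf i' r = Leaf")
      case True
      have "nleaves (del_leaf i' r) = nleaves r - 1"
        using right carets_del_leaf[OF i'r] by (cases r; simp add: nleaves_carets)
      then have "nleaves r \<le> 2" using True by simp
      then have "i' \<le> 1" using i'r by simp
      then show ?thesis using True Caret.prems right i by auto
    next
      case False
      then have "j \<in> exposed l n \<or> j \<in> exposed (del_leaf i' r) (n + nleaves l)"
        using Caret.prems right i by (auto split: if_splits)
      then show ?thesis
      proof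
        assume j: "j \<in> exposed l n"
        then show ?thesis using right i exposed_bounds[OF j] by auto
      next
        assume "j \<in> exposed (del_leaf i' r) (n + nleaves l)"
        then show ?thesis using Caret.IH(2)[OF i'r, of "n + nleaves l"] right i by (auto simp: ac_simps)
      qed
    qed
  qed
qed

section \<open>Labels that make the deletion of a leaf invertible\<close>

fun ldepth :: "tree \<Rightarrow> nat" where
  "ldepth Leaf = 0"
| "ldepth (Caret l r) = Suc (ldepth l)"

fun rdepth :: "tree \<Rightarrow> nat" where
  "rdepth Leaf = 0"
| "rdepth (Caret l r) = Suc (rdepth r)"

text \<open>The datum lost by \<open>del_leaf\<close>: the side on which the leaf hung
  (\<open>True\<close> for a left child) and the height of its sibling along the edge facing the
  leaf. The sibling of a left child is one of the subtrees that begin with the next leaf; these form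
  a chain, told apart by \<open>ldepth\<close>. Right children are dual. The value at
  \<open>Leaf\<close> is a default.\<close>

fun leaf_label :: "nat \<Rightarrow> tree \<Rightarrow> bool \<times> nat" where
  "leaf_label i Leaf = (True, 0)"
| "leaf_label i (Caret l r) =
     (if i < nleaves l then (if l = Leaf then (True, ldepth r) else leaf_label i l)
      else (if r = Leaf then (False, rdepth l) else leaf_label (i - nleaves l) r))"

text \<open>The sibling of the first leaf lies on the left edge of the pruned tree, hence the bound.
  Applied to the left subtree of a tree, it separates an insertion inside that subtree from an
  insertion above the root, whose label is strictly larger.\<close>

lemma first_leaf_label:
  "t \<noteq> Leaf \<Longrightarrow> fst (leaf_label 0 t) \<and> snd (leaf_label 0 t) \<le> ldepth (del_leaf 0 t)"
  by (induction t) auto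

lemma last_leaf_label:
  "t \<noteq> Leaf \<Longrightarrow> \<not> fst (leaf_label (nleaves t - 1) t) \<and>
     snd (leaf_label (nleaves t - 1) t) \<le> rdepth (del_leaf (nleaves t - 1) t)"
proof (induction t)
  case (Caret l r)
  show ?case
  proof (cases "r = Leaf")
    case False
    then have "nleaves l + nleaves r - 1 - nleaves l = nleaves r - 1" by simp
    moreover have "\<not> nleaves l + nleaves r - 1 < nleaves l"
      using nleaves_pos[of r] by linarith
    ultimately show ?thesis using False Caret by simp
  qed auto
qed auto

text \<open>The roots of the two trees are compared. If the leaf hangs at the root of one tree and
  deeper in the other, the labels have different heights or the leaf counts clash; if it lies on
  different sides of the two roots, the labels differ in the side; otherwise the induction
  hypothesis applies to a subtree.\<close>

lemma del_leaf_label_inj: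
  assumes "del_leaf i s = del_leaf i t" "leaf_label i s = leaf_label i t"
    "i < nleaves s" "nleaves s = nleaves t"
  shows "s = t"
  using assms
proof (induction s arbitrary: i t)
  case Leaf
  then show ?case by (metis nleaves.simps(1) nleaves_eq_1 One_nat_def)
next
  case (Caret l r)
  obtain l2 r2 where t: "t = Caret l2 r2"
    using Caret.prems(4) by (cases t) (auto simp: nleaves_carets)
  have nl: "nleaves (del_leaf j u) = nleaves u - 1" if "j < nleaves u" "u \<noteq> Leaf" for j u
    using carets_del_leaf[OF that(1)] that(2) by (cases u) (auto simp: nleaves_carets)
  have first: False if "del_leaf 0 u = r'" "v = Caret a b" "a \<noteq> Leaf" "u = Caret Leaf r'"
     "del_leaf 0 v = r'" "leaf_label 0 u = leaf_label 0 v" for u v a b r'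
  proof -
    have "leaf_label 0 a = (True, Suc (ldepth (del_leaf 0 a)))"
      using that by auto
    then show False using first_leaf_label[of a] that by simp
  qed
  have last: False if "v = Caret a b" "b \<noteq> Leaf" "u = Caret l' Leaf" "nleaves u = nleaves v"
     "del_leaf (nleaves l') v = l'" "leaf_label (nleaves l') u = leaf_label (nleaves l') v" for u v a b l'
  proof -
    have e: "nleaves l' - nleaves a = nleaves b - 1" "\<not> nleaves l' < nleaves a"
      using that nleaves_pos[of b] by (auto simp del: nleaves_pos)
    have "leaf_label (nleaves b - 1) b = (False, Suc (rdepth (del_leaf (nleaves b - 1) b)))"
      using that e by auto
    then show False using that(2) last_leaf_label[of b] by simp
  qed
  have c2: "i < nleaves (Caret l2 r2)" using Caret.prems t by simp
  show ?case
    using Caret.prems(3)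
  proof (cases rule: leaf_cases)
    case leftLeaf
    show ?thesis using c2
    proof (cases rule: leaf_cases)
      case left then show ?thesis using leftLeaf Caret.prems t first[of "Caret l r" r t l2 r2] by auto
    qed (use leftLeaf Caret.prems t in auto)
  next
    case left
    note L = left
    show ?thesis using c2
    proof (cases rule: leaf_cases)
      case leftLeaf then show ?thesis using L Caret.prems t first[of t r2 "Caret l r" l r] by auto
    next
      case left
      then show ?thesis using Caret.prems t L Caret.IH(1)[of i l2] by auto
    next
      case rightLeaf
      then show ?thesis using Caret.prems t L by (auto simp: nleaves_carets)
    next
      case right
      then have eq: "Caret (del_leaf i l) r = Caret l2 (del_leaf (i - nleaves l2) r2)"
        using Caret.prems(1) t right L by auto
      then have "nleaves l2 = nleaves l - 1" using nl[of i l] L by auto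
      \<comment> \<open>Leaf \<open>i\<close> ends the left subtree of one tree and begins the right
        subtree of the other, so it is a right child here and a left child there.\<close>
      then have "i = nleaves l - 1" "i - nleaves l2 = 0" using right L by auto
      then have "leaf_label (nleaves l - 1) l = leaf_label 0 r2"
        using Caret.prems(2) t right L by simp
      then show ?thesis using last_leaf_label[of l] first_leaf_label[of r2] right L by simp
    qed
  next
    case rightLeaf
    note R = rightLeaf
    show ?thesis using c2
    proof (cases rule: leaf_cases)
      case left then show ?thesis using R Caret.prems t by (auto simp: nleaves_carets)
    next
      case rightLeaf then show ?thesis using R Caret.prems t by auto
    next
      case right then show ?thesis using R Caret.prems t last[of t l2 r2 "Caret l r" l] by auto
    qed (use R Caret.prems t in auto)
  next
    case right
    note R = right
    show ?thesis using c2
    proof (cases rule: leaf_cases)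
      case left
      then have eq: "Caret (del_leaf i l2) r2 = Caret l (del_leaf (i - nleaves l) r)"
        using Caret.prems(1) t left R by auto
      then have "nleaves l = nleaves l2 - 1" using nl[of i l2] left by auto
      then have "i = nleaves l2 - 1" "i - nleaves l = 0" using R left by auto
      then have "leaf_label (nleaves l2 - 1) l2 = leaf_label 0 r"
        using Caret.prems(2) t left R by simp
      then show ?thesis using last_leaf_label[of l2] first_leaf_label[of r] left R by simp
    next
      case rightLeaf then show ?thesis using R Caret.prems t last[of "Caret l r" l r t l2] by auto
    next
      case right
      then have "l = l2" "del_leaf (i - nleaves l) r = del_leaf (i - nleaves l) r2"
        "leaf_label (i - nleaves l) r = leaf_label (i - nleaves l) r2"
        using Caret.prems t R by auto
      then show ?thesis using Caret.prems t R Caret.IH(2)[of "i - nleaves l" r2] by auto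
    qed (use R Caret.prems t in auto)
  qed
qed

text \<open>Each caret lies on one maximal left path and on one maximal right path, and each such
  path is measured by at most one leaf, namely the sibling of its top. The two outer edges of the
  whole tree are measured by no leaf yet; adding them makes the induction close.\<close>

lemma sum_leaf_label:
  "(\<Sum>i<nleaves t. snd (leaf_label i t)) + ldepth t + rdepth t \<le> 2 * carets t"
proof (induction t)
  case (Caret l r)
  have split: "(\<Sum>i<a + b. F i) = (\<Sum>i<a. F i) + (\<Sum>i<b. F (a + i))" for F :: "nat \<Rightarrow> nat" and a b
    by (induction b) auto
  have L: "(\<Sum>i<nleaves l. snd (leaf_label i (Caret l r))) =
      (if l = Leaf then ldepth r else (\<Sum>i<nleaves l. snd (leaf_label i l)))" by simp
  have R: "(\<Sum>i<nleaves r. snd (leaf_label (nleaves l + i) (Caret l r))) =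
      (if r = Leaf then rdepth l else (\<Sum>i<nleaves r. snd (leaf_label i r)))" by simp
  have "(\<Sum>i<nleaves (Caret l r). snd (leaf_label i (Caret l r))) =
     (\<Sum>i<nleaves l. snd (leaf_label i (Caret l r))) +
     (\<Sum>i<nleaves r. snd (leaf_label (nleaves l + i) (Caret l r)))"
    using split[of _ "nleaves l" "nleaves r"] by simp
  also have "\<dots> + ldepth (Caret l r) + rdepth (Caret l r) \<le> 2 * carets (Caret l r)"
    unfolding L R using Caret by (auto split: if_splits)
  finally show ?case .
qed auto

subsection \<open>The growth of the number of reduced diagrams\<close>

text \<open>An associativity move at the parent of the exposed caret at \<open>p\<close>: the caret
  is broken up and its inner leaf is joined to the other subtree of the parent. A newly exposed
  caret can only start at \<open>p - 1\<close> or \<open>p + 1\<close>. The tree with a single caret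
  has no such parent, which is why it is excluded below.\<close>

fun rotate_at :: "nat \<Rightarrow> tree \<Rightarrow> tree" where
  "rotate_at p Leaf = Leaf"
| "rotate_at p (Caret l r) =
     (if l = Caret Leaf Leaf \<and> p = 0 then Caret Leaf (Caret Leaf r)
      else if r = Caret Leaf Leaf \<and> p = nleaves l then Caret (Caret l Leaf) Leaf
      else if p < nleaves l then Caret (rotate_at p l) r
      else Caret l (rotate_at (p - nleaves l) r))"

text \<open>The direction of the rotation can be read off afterwards: either leaf \<open>p\<close>
  hangs alone on the left of the rotated caret, or leaf \<open>p + 1\<close> hangs alone on its
  right. The results \<open>Leaf\<close> are defaults that no rotated tree reaches.\<close>

fun unrotate_at :: "nat \<Rightarrow> tree \<Rightarrow> tree" where
  "unrotate_at p Leaf = Leaf"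
| "unrotate_at p (Caret l r) =
     (if l = Leaf \<and> p = 0
      then (case r of Leaf \<Rightarrow> Leaf | Caret a b \<Rightarrow> Caret (Caret Leaf Leaf) b)
      else if r = Leaf \<and> nleaves l = Suc p
      then (case l of Leaf \<Rightarrow> Leaf | Caret a b \<Rightarrow> Caret a (Caret Leaf Leaf))
      else if p < nleaves l then Caret (unrotate_at p l) r
      else Caret l (unrotate_at (p - nleaves l) r))"

lemma carets_rotate_at:
  "p \<in> exposed t 0 \<Longrightarrow> t \<noteq> Caret Leaf Leaf \<Longrightarrow> carets (rotate_at p t) = carets t"
  and rotate_at_not_Leaf: "p \<in> exposed t 0 \<Longrightarrow> rotate_at p t \<noteq> Leaf"
proof (induction t arbitrary: p)
  case (Caret l r)
  case 1
  show ?case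
  proof (cases "p < nleaves l")
    case True
    then have "p \<in> exposed l 0" using 1 exposed_bounds[of p r "nleaves l"] by (auto split: if_splits)
    moreover from this have "l = Caret Leaf Leaf \<Longrightarrow> p = 0" by simp
    ultimately show ?thesis using Caret(1)[of p] True by auto
  next
    case False
    then have "p - nleaves l \<in> exposed r 0"
      using 1 exposed_bounds[of p l 0] mem_exposed_shift[of p r 0 "nleaves l"]
      by (auto split: if_splits)
    moreover from this have "r = Caret Leaf Leaf \<Longrightarrow> p = nleaves l" using False by simp
    ultimately show ?thesis using Caret(3)[of "p - nleaves l"] False by auto
  qed
qed auto

lemma exposed_Caret_cases [consumes 2, case_names left right]:
  assumes "p \<in> exposed (Caret l r) 0" "Caret l r \<noteq> Caret Leaf Leaf"
  obtains "p \<in> exposed l 0" "Suc p < nleaves l" "l = Caret Leaf Leaf \<Longrightarrow> p = 0"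
  | "nleaves l \<le> p" "p - nleaves l \<in> exposed r 0" "r = Caret Leaf Leaf \<Longrightarrow> p = nleaves l"
proof (cases "p \<in> exposed l 0")
  case True
  then have "Suc p < nleaves l" "l = Caret Leaf Leaf \<Longrightarrow> p = 0"
    using exposed_bounds[of p l 0] by auto
  then show ?thesis using that(1) True by blast
next
  case False
  then have "p \<in> exposed r (0 + nleaves l)" using assms by (auto split: if_splits)
  then have "nleaves l \<le> p" "p - nleaves l \<in> exposed r 0"
    unfolding mem_exposed_shift by auto
  moreover from this have "r = Caret Leaf Leaf \<Longrightarrow> p = nleaves l" by auto
  ultimately show ?thesis using that(2) by blast
qed

lemma unrotate_rotate_at:
  "p \<in> exposed t 0 \<Longrightarrow> t \<noteq> Caret Leaf Leaf \<Longrightarrow> unrotate_at p (rotate_at p t) = t"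
proof (induction t arbitrary: p)
  case (Caret l r)
  show ?case
    using Caret.prems
  proof (cases rule: exposed_Caret_cases)
    case left
    show ?thesis
    proof (cases "l = Caret Leaf Leaf")
      case False
      then have "carets (rotate_at p l) = carets l" "rotate_at p l \<noteq> Leaf"
        using left carets_rotate_at rotate_at_not_Leaf by auto
      then show ?thesis using left False Caret.IH(1)[of p] by (auto simp: nleaves_carets)
    qed (use left in auto)
  next
    case right
    show ?thesis
    proof (cases "r = Caret Leaf Leaf")
      case True
      then show ?thesis using right by (auto simp: nleaves_carets split: tree.splits)
    next
      case False
      then have "rotate_at (p - nleaves l) r \<noteq> Leaf"
        using right rotate_at_not_Leaf by auto
      then show ?thesis using right False Caret.IH(2)[of "p - nleaves l"]
        by (auto simp: nleaves_carets)
    qed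
  qed
qed auto

lemma exposed_rotate_at:
  "p \<in> exposed t 0 \<Longrightarrow> t \<noteq> Caret Leaf Leaf \<Longrightarrow>
     j \<in> exposed (rotate_at p t) 0 \<Longrightarrow> j = Suc p \<or> Suc j = p \<or> (j \<noteq> p \<and> j \<in> exposed t 0)"
proof (induction t arbitrary: p j)
  case (Caret l r)
  show ?case
    using Caret.prems(1,2)
  proof (cases rule: exposed_Caret_cases)
    case left
    show ?thesis
    proof (cases "l = Caret Leaf Leaf")
      case True
      then have e: "exposed (rotate_at p (Caret l r)) 0 = (if r = Leaf then {1} else exposed r 2)"
        using left by (auto simp: numeral_2_eq_2)
      then show ?thesis using Caret.prems True left exposed_bounds[of j r 2]
        by (auto simp: numeral_2_eq_2 split: if_splits)
    next
      case False
      then have nl: "carets (rotate_at p l) = carets l" "rotate_at p l \<noteq> Leaf"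
        using left carets_rotate_at rotate_at_not_Leaf by auto
      then have "j \<in> exposed (rotate_at p l) 0 \<or> j \<in> exposed r (nleaves l)"
        using Caret.prems False left by (auto simp: nleaves_carets split: if_splits)
      then show ?thesis using Caret.IH(1)[of p j] left False exposed_bounds[of j r "nleaves l"]
        by (auto split: if_splits)
    qed
  next
    case right
    show ?thesis
    proof (cases "r = Caret Leaf Leaf")
      case True
      have j: "j \<in> (if l = Leaf then {0} else exposed l 0)"
        using Caret.prems True right by (auto split: if_splits)
      show ?thesis
      proof (cases "l = Leaf")
        case True
        then show ?thesis using j right \<open>r = _\<close> by auto
      next
        case False
        then have "j \<in> exposed l 0" using j by simp
        then show ?thesis using exposed_bounds[of j l 0] right True False by auto
      qed
    next
      case False
      then have nl: "rotate_at (p - nleaves l) r \<noteq> Leaf"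
        using right rotate_at_not_Leaf by auto
      have eq: "rotate_at p (Caret l r) = Caret l (rotate_at (p - nleaves l) r)"
        using right False by (auto simp: nleaves_carets)
      have "j \<in> exposed l 0 \<or> j \<in> exposed (rotate_at (p - nleaves l) r) (0 + nleaves l)"
        using Caret.prems(3) nl unfolding eq by (auto split: if_splits)
      then show ?thesis
      proof
        assume "j \<in> exposed l 0"
        then show ?thesis using exposed_bounds[of j l 0] right by auto
      next
        assume "j \<in> exposed (rotate_at (p - nleaves l) r) (0 + nleaves l)"
        then have "nleaves l \<le> j" "j - nleaves l \<in> exposed (rotate_at (p - nleaves l) r) 0"
          unfolding mem_exposed_shift by auto
        then show ?thesis using Caret.IH(2)[of "p - nleaves l" "j - nleaves l"] right False
          mem_exposed_shift[of j r 0 "nleaves l"] by auto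
      qed
    qed
  qed
qed auto

section \<open>Counting trees with forbidden exposed positions\<close>

definition avoiding :: "nat \<Rightarrow> nat set \<Rightarrow> tree set" where
  "avoiding n P = {t. carets t = n \<and> exposed t 0 \<inter> P = {}}"

lemma finite_avoiding [simp]: "finite (avoiding n P)"
  unfolding avoiding_def using finite_carets[of n] by (rule rev_finite_subset) auto

text \<open>The trees gained by permitting \<open>p\<close> are those that expose \<open>p\<close>.
  Rotating them at \<open>p\<close> is injective and lands among the trees that avoid all of
  \<open>P\<close>, because \<open>P\<close> has no two neighbouring elements. So permitting one
  position at most doubles the count.\<close>

lemma card_avoiding_remove:
  assumes "2 \<le> n" "\<And>j. j \<in> P \<Longrightarrow> Suc j \<notin> P"
  shows "card (avoiding n (P - {p})) \<le> 2 * card (avoiding n P)"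
proof (cases "p \<in> P")
  case True
  let ?B = "{t \<in> avoiding n (P - {p}). p \<in> exposed t 0}"
  have nt: "t \<noteq> Caret Leaf Leaf" if "t \<in> ?B" for t
    using that assms(1) by (auto simp: avoiding_def)
  have "inj_on (rotate_at p) ?B"
    by (rule inj_on_inverseI[of _ "unrotate_at p"]) (use nt unrotate_rotate_at in auto)
  moreover have "rotate_at p ` ?B \<subseteq> avoiding n P"
  proof
    fix u assume "u \<in> rotate_at p ` ?B"
    then obtain t where t: "t \<in> ?B" "u = rotate_at p t" by auto
    have "j \<notin> P" if "j \<in> exposed u 0" for j
      using exposed_rotate_at[of p t j] t nt[OF t(1)] that assms(2)[of p] assms(2)[of j] True
      by (auto simp: avoiding_def)
    then show "u \<in> avoiding n P"
      using t carets_rotate_at[of p t] nt[OF t(1)] by (auto simp: avoiding_def)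
  qed
  ultimately have "card ?B \<le> card (avoiding n P)"
    by (metis card_image card_mono finite_avoiding)
  moreover have "avoiding n (P - {p}) = avoiding n P \<union> ?B" by (auto simp: avoiding_def)
  then have "card (avoiding n (P - {p})) \<le> card (avoiding n P) + card ?B"
    by (metis card_Un_le)
  ultimately show ?thesis by simp
qed simp

definition diagrams :: "nat \<Rightarrow> diagram set" where
  "diagrams n = {d \<in> Xdiag. dsize d = n}"

lemma mem_diagrams:
  "(s, t) \<in> diagrams n \<longleftrightarrow> carets s = n \<and> carets t = n \<and> exposed s 0 \<inter> exposed t 0 = {}"
  by (auto simp: diagrams_def Xdiag_def reduced_def dsize_def)

lemma diagrams_Sigma: "diagrams n = (SIGMA s:{s. carets s = n}. avoiding n (exposed s 0))"
  by (auto simp: mem_diagrams avoiding_def)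

lemma finite_diagrams [simp]: "finite (diagrams n)"
  by (simp add: diagrams_Sigma finite_carets)

text \<open>Pairs of trees whose common exposed carets lie next to position i: what remains of a
  reduced diagram after its leaf i has been deleted from both trees.\<close>

definition reduced_off :: "nat \<Rightarrow> nat \<Rightarrow> diagram set" where
  "reduced_off n i = {(s, t). carets s = n \<and> carets t = n \<and>
     (\<forall>j \<in> exposed s 0 \<inter> exposed t 0. i \<le> j + 2 \<and> j \<le> i)}"

text \<open>For a fixed first tree, the positions \<open>i\<close>, \<open>i - 1\<close> and
  \<open>i - 2\<close> are permitted one after the other, each at the cost of a factor 2. Truncated
  subtraction for small \<open>i\<close> only repeats a position.\<close>

lemma card_reduced_off:
  assumes "2 \<le> n"
  shows "card (reduced_off n i) \<le> 8 * card (diagrams n)"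
proof -
  have le: "card (avoiding n (exposed s 0 - {i} - {i - 1} - {i - 2})) \<le> 8 * card (avoiding n (exposed s 0))" for s
  proof -
    have "card (avoiding n (exposed s 0 - {i} - {i - 1} - {i - 2})) \<le> 2 * card (avoiding n (exposed s 0 - {i} - {i - 1}))"
      using exposed_separated[of _ s 0] by (intro card_avoiding_remove assms) auto
    also have "card (avoiding n (exposed s 0 - {i} - {i - 1})) \<le> 2 * card (avoiding n (exposed s 0 - {i}))"
      using exposed_separated[of _ s 0] by (intro card_avoiding_remove assms) auto
    also have "card (avoiding n (exposed s 0 - {i})) \<le> 2 * card (avoiding n (exposed s 0))"
      using exposed_separated[of _ s 0] by (intro card_avoiding_remove assms) auto
    finally show ?thesis by simp
  qed
  have "reduced_off n i \<subseteq> (SIGMA s:{s. carets s = n}. avoiding n (exposed s 0 - {i} - {i - 1} - {i - 2}))"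
  proof
    fix x assume x: "x \<in> reduced_off n i"
    obtain s t where st: "x = (s, t)" by (cases x)
    have "j = i \<or> j = i - 1 \<or> j = i - 2" if "j \<in> exposed s 0 \<inter> exposed t 0" for j
    proof -
      have "i \<le> j + 2 \<and> j \<le> i" using x that by (auto simp: st reduced_off_def)
      then show ?thesis by linarith
    qed
    then show "x \<in> (SIGMA s:{s. carets s = n}. avoiding n (exposed s 0 - {i} - {i - 1} - {i - 2}))"
      using x by (auto simp: st reduced_off_def avoiding_def)
  qed
  then have "card (reduced_off n i) \<le> card (SIGMA s:{s. carets s = n}. avoiding n (exposed s 0 - {i} - {i - 1} - {i - 2}))"
    by (intro card_mono finite_SigmaI finite_carets) auto
  also have "\<dots> = (\<Sum>s | carets s = n. card (avoiding n (exposed s 0 - {i} - {i - 1} - {i - 2})))"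
    by (simp add: finite_carets)
  also have "\<dots> \<le> (\<Sum>s | carets s = n. 8 * card (avoiding n (exposed s 0)))"
    by (intro sum_mono le)
  also have "\<dots> = 8 * card (diagrams n)"
    by (simp add: diagrams_Sigma finite_carets sum_distrib_left)
  finally show ?thesis .
qed

lemma finite_reduced_off [simp]: "finite (reduced_off n i)"
  by (rule finite_subset[of _ "{s. carets s = n} \<times> {s. carets s = n}"])
     (auto simp: reduced_off_def finite_carets)

text \<open>Markov's inequality. The labels sum to at most \<open>2 * (n + 1)\<close>, so the
  threshold 8 leaves at most a quarter of the leaves above it, and two trees together spoil at most
  half of them.\<close>

lemma card_large_labels:
  "carets t = Suc n \<Longrightarrow> 4 * card {i. i < n + 2 \<and> 8 \<le> snd (leaf_label i t)} \<le> n + 1"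
proof -
  assume t: "carets t = Suc n"
  let ?B = "{i. i < n + 2 \<and> 8 \<le> snd (leaf_label i t)}"
  have "8 * card ?B = (\<Sum>i\<in>?B. 8)" by simp
  also have "\<dots> \<le> (\<Sum>i\<in>?B. snd (leaf_label i t))" by (intro sum_mono) auto
  also have "\<dots> \<le> (\<Sum>i<nleaves t. snd (leaf_label i t))"
    by (intro sum_mono2) (auto simp: nleaves_carets t)
  also have "\<dots> \<le> 2 * carets t" by (rule add_leD1[OF add_leD1[OF sum_leaf_label]])
  finally show ?thesis using t by simp
qed

text \<open>Double counting of the pairs (d, i), where i is one of the at least (n + 2) / 2 leaves
  whose labels in both trees of d are small: such a pair is determined by i, the two labels
  and the two trees with leaf i deleted.\<close>

lemma card_diagrams_Suc:
  assumes "2 \<le> n"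
  shows "card (diagrams (Suc n)) \<le> 4096 * card (diagrams n)"
proof -
  \<comment> \<open>Two sides and eight heights give 16 labels per tree, hence 256 pairs; with the
    factor 8 of \<open>card_reduced_off\<close> and a factor 2 for using only half of the leaves
    this makes 4096.\<close>
  define L where "L = (UNIV :: bool set) \<times> {..<8::nat}"
  have cL: "finite L" "card L = 16" by (simp_all add: L_def)
  define G where "G d = {i. i < n + 2 \<and> leaf_label i (fst d) \<in> L \<and> leaf_label i (snd d) \<in> L}" for d :: diagram
  have G: "n + 2 \<le> 2 * card (G d)" "finite (G d)" if "d \<in> diagrams (Suc n)" for d
  proof -
    obtain s t where d: "d = (s, t)" by (cases d)
    then have c: "carets s = Suc n" "carets t = Suc n" using that by (auto simp: mem_diagrams)
    let ?A = "\<lambda>s. {i. i < n + 2 \<and> 8 \<le> snd (leaf_label i s)}"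
    have U: "{..<n + 2} = G d \<union> ?A s \<union> ?A t"
      by (auto simp: G_def d L_def mem_Times_iff not_le)
    have "n + 2 = card (G d \<union> ?A s \<union> ?A t)" unfolding U[symmetric] by simp
    also have "\<dots> \<le> card (G d \<union> ?A s) + card (?A t)" by (rule card_Un_le)
    also have "\<dots> \<le> card (G d) + card (?A s) + card (?A t)"
      by (intro add_right_mono card_Un_le)
    finally have "n + 2 \<le> card (G d) + card (?A s) + card (?A t)" .
    then show "n + 2 \<le> 2 * card (G d)"
      using card_large_labels[OF c(1)] card_large_labels[OF c(2)] by linarith
    show "finite (G d)" by (simp add: G_def)
  qed
  let ?W = "SIGMA d:diagrams (Suc n). G d"
  let ?V = "SIGMA i:{..<n + 2}. (L \<times> L) \<times> reduced_off n i"
  define F where "F = (\<lambda>(d::diagram, i). (i, (leaf_label i (fst d), leaf_label i (snd d)),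
     (del_leaf i (fst d), del_leaf i (snd d))))"
  have "inj_on F ?W"
  proof (rule inj_onI)
    fix x y assume xy: "x \<in> ?W" "y \<in> ?W" "F x = F y"
    obtain s t i where x: "x = ((s, t), i)" by (cases x) auto
    obtain s' t' i' where y: "y = ((s', t'), i')" by (cases y) auto
    show "x = y"
      using xy del_leaf_label_inj[of i s s'] del_leaf_label_inj[of i t t'] unfolding x y
      by (auto simp: F_def mem_diagrams G_def nleaves_carets)
  qed
  moreover have "F ` ?W \<subseteq> ?V"
  proof
    fix v assume "v \<in> F ` ?W"
    then obtain s t i where v: "(s, t) \<in> diagrams (Suc n)" "i \<in> G (s, t)" "v = F ((s, t), i)"
      by auto
    have i: "i < nleaves s" "i < nleaves t" "i < n + 2"
      using v by (auto simp: G_def mem_diagrams nleaves_carets)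
    \<comment> \<open>Outside the window both trees fall under the same alternative of
      \<open>exposed_del_leaf\<close>, so a common exposed caret of the pruned trees would come from
      one of \<open>s\<close> and \<open>t\<close>, at \<open>j\<close> or at
      \<open>Suc j\<close>.\<close>
    have "i \<le> j + 2 \<and> j \<le> i" if "j \<in> exposed (del_leaf i s) 0 \<inter> exposed (del_leaf i t) 0" for j
      using exposed_del_leaf[OF i(1), of j 0] exposed_del_leaf[OF i(2), of j 0] that v(1)
      by (auto simp: mem_diagrams)
    then have "(del_leaf i s, del_leaf i t) \<in> reduced_off n i"
      using v(1) i carets_del_leaf[of i s] carets_del_leaf[of i t]
      by (auto simp: reduced_off_def mem_diagrams)
    then show "v \<in> ?V" using v i by (simp add: F_def G_def)
  qed
  moreover have "finite ?V" using cL by (intro finite_SigmaI finite_cartesian_product) auto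
  ultimately have "card ?W \<le> card ?V" by (rule card_inj_on_le)
  have sum_const: "2 * (\<Sum>i<m. 256 * (8 * c)) = m * (4096 * c)" for m c :: nat by simp
  have "(n + 2) * card (diagrams (Suc n)) \<le> (\<Sum>d\<in>diagrams (Suc n). 2 * card (G d))"
    using sum_mono[of "diagrams (Suc n)" "\<lambda>_. n + 2" "\<lambda>d. 2 * card (G d)"] G(1)
    by (simp add: mult.commute)
  also have "\<dots> = 2 * card ?W" using G(2) by (simp add: sum_distrib_left)
  also have "\<dots> \<le> 2 * card ?V" using \<open>card ?W \<le> card ?V\<close> by simp
  also have "2 * card ?V = 2 * (\<Sum>i<n + 2. 256 * card (reduced_off n i))"
    using cL by (simp add: card_cartesian_product)
  also have "\<dots> \<le> 2 * (\<Sum>i<n + 2. 256 * (8 * card (diagrams n)))"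
    by (intro sum_mono mult_left_mono card_reduced_off assms) auto
  also have "\<dots> = (n + 2) * (4096 * card (diagrams n))"
    by (rule sum_const)
  finally have "(n + 2) * card (diagrams (Suc n)) \<le> (n + 2) * (4096 * card (diagrams n))" .
  then show ?thesis by (simp only: mult_le_cancel1)
qed

subsection \<open>Counting tuples\<close>

lemma positive_densityI:
  assumes "\<And>n. N \<le> n \<Longrightarrow> card (sphere nrm k n) \<le> C * card (T \<inter> sphere nrm k n)"
    and "\<And>n. N \<le> n \<Longrightarrow> 0 < card (sphere nrm k n)"
  shows "positive_density nrm k T"
proof -
  have C: "0 < C" using assms(1)[of N] assms(2)[of N] by (cases C) auto
  have "ereal (1 / real C) \<le> ereal (real (card (T \<inter> sphere nrm k n)) / real (card (sphere nrm k n)))"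
    if "N \<le> n" for n
  proof -
    have "real (card (sphere nrm k n)) \<le> real C * real (card (T \<inter> sphere nrm k n))"
      using assms(1)[OF that] by (metis of_nat_le_iff of_nat_mult)
    then show ?thesis using C assms(2)[OF that] by (simp add: field_simps)
  qed
  then have "ereal (1 / real C) \<le>
      liminf (\<lambda>n. ereal (real (card (T \<inter> sphere nrm k n)) / real (card (sphere nrm k n))))"
    by (intro Liminf_bounded) (auto simp: eventually_sequentially)
  moreover have "0 < ereal (1 / real C)" using C by simp
  ultimately show ?thesis unfolding positive_density_def by (rule order.strict_trans2[rotated])
qed

lemma card_lists_le_mset:
  assumes "finite A" "\<And>xs. xs \<in> A \<Longrightarrow> length xs = k"
  shows "card A \<le> fact k * card (mset ` A)"
proof -
  have "A \<subseteq> (\<Union>M\<in>mset ` A. permutations_of_multiset M)"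
    by (auto simp: permutations_of_multiset_def)
  then have "card A \<le> card (\<Union>M\<in>mset ` A. permutations_of_multiset M)"
    using assms(1) by (intro card_mono) auto
  also have "\<dots> \<le> (\<Sum>M\<in>mset ` A. card (permutations_of_multiset M))"
    using assms(1) by (intro card_UN_le) auto
  also have "\<dots> \<le> (\<Sum>M\<in>mset ` A. fact k)"
    using assms(2) by (intro sum_mono) (auto simp: card_permutations_of_multiset)
  finally show ?thesis by (simp add: mult.commute)
qed

lemma ratio_iterate:
  fixes s :: "nat \<Rightarrow> nat"
  assumes "\<And>n. N \<le> n \<Longrightarrow> s (Suc n) \<le> K * s n" "N \<le> n"
  shows "s (n + c) \<le> K ^ c * s n"
proof (induction c)
  case (Suc c)
  have "s (n + Suc c) \<le> K * s (n + c)" using assms(1)[of "n + c"] assms(2) by simp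
  also have "\<dots> \<le> K * (K ^ c * s n)" by (intro mult_left_mono Suc.IH) simp
  finally show ?case by (simp add: mult.assoc)
qed simp

section \<open>Ordered tuples by total size\<close>

definition sum_lists :: "nat \<Rightarrow> nat \<Rightarrow> diagram list set" where
  "sum_lists k n = {xs. length xs = k \<and> set xs \<subseteq> Xdiag \<and> sum_list (map dsize xs) = n}"

lemma sum_lists_Suc:
  "bij_betw (\<lambda>(i, d, xs). d # xs) (SIGMA i:{..n}. diagrams i \<times> sum_lists k (n - i))
     (sum_lists (Suc k) n)"
proof (rule bij_betwI[where g = "\<lambda>xs. (dsize (hd xs), hd xs, tl xs)"])
  show "(\<lambda>xs. (dsize (hd xs), hd xs, tl xs))
      \<in> sum_lists (Suc k) n \<rightarrow> (SIGMA i:{..n}. diagrams i \<times> sum_lists k (n - i))"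
  proof
    fix xs assume "xs \<in> sum_lists (Suc k) n"
    then show "(dsize (hd xs), hd xs, tl xs) \<in> (SIGMA i:{..n}. diagrams i \<times> sum_lists k (n - i))"
      by (cases xs) (auto simp: sum_lists_def diagrams_def)
  qed
qed (auto simp: sum_lists_def diagrams_def length_Suc_conv)

lemma finite_sum_lists [simp]: "finite (sum_lists k n)"
proof (induction k arbitrary: n)
  case 0
  show ?case by (rule finite_subset[of _ "{[]}"]) (auto simp: sum_lists_def)
next
  case (Suc k)
  then show ?case using bij_betw_finite[OF sum_lists_Suc[of n k]] by auto
qed

lemma card_sum_lists_Suc:
  "card (sum_lists (Suc k) n) = (\<Sum>i\<le>n. card (diagrams i) * card (sum_lists k (n - i)))"
  by (simp add: bij_betw_same_card[OF sum_lists_Suc, symmetric] card_cartesian_product)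

text \<open>In the convolution over the size of the first entry, each increase of the total is
  charged to the tail if the tail is large, with factor \<open>K\<close>, and otherwise to the first
  entry, with factor 4096. The threshold reflects that single diagrams satisfy a ratio bound only
  from size 2 on: there is no reduced diagram of size 1, but there are two of size 2.\<close>

lemma card_sum_lists_ratio:
  "\<exists>K. \<forall>n \<ge> 2 * k. card (sum_lists k (Suc n)) \<le> K * card (sum_lists k n)"
proof (induction k)
  case 0
  have "sum_lists 0 (Suc n) = {}" for n by (auto simp: sum_lists_def)
  then show ?case by simp
next
  case (Suc k)
  then obtain K where K: "\<And>n. 2 * k \<le> n \<Longrightarrow> card (sum_lists k (Suc n)) \<le> K * card (sum_lists k n)"
    by blast
  define r where "r i = card (diagrams i)" for i
  define s where "s i = card (sum_lists k i)" for i
  have r: "r (Suc i) \<le> 4096 * r i" if "2 \<le> i" for i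
    using card_diagrams_Suc[OF that] by (simp add: r_def)
  have s: "s (Suc i) \<le> K * s i" if "2 * k \<le> i" for i
    using K[OF that] by (simp add: s_def)
  have "card (sum_lists (Suc k) (Suc n)) \<le> (K + 4096) * card (sum_lists (Suc k) n)"
    if n: "2 * Suc k \<le> n" for n
  proof -
    \<comment> \<open>\<open>?a\<close> pays for the terms charged to the tail, \<open>?b\<close>
      for those charged to the first entry. The zero values pad both sums to the index range up to
      \<open>Suc n\<close>.\<close>
    let ?a = "\<lambda>i. if i \<le> n then K * (r i * s (n - i)) else 0"
    let ?b = "\<lambda>i. case i of 0 \<Rightarrow> 0 | Suc j \<Rightarrow> 4096 * (r j * s (n - j))"
    have "r i * s (Suc n - i) \<le> ?a i + ?b i" if i: "i \<le> Suc n" for i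
    proof (cases "i + 2 * k \<le> n")
      case True
      then have "s (Suc n - i) \<le> K * s (n - i)" using s[of "n - i"] by (simp add: Suc_diff_le)
      then have "r i * s (Suc n - i) \<le> r i * (K * s (n - i))" by (rule mult_left_mono) simp
      also have "\<dots> = K * (r i * s (n - i))" by (rule mult.left_commute)
      also have "\<dots> \<le> ?a i + ?b i" using True by simp
      finally show ?thesis .
    next
      case False
      then obtain j where j: "i = Suc j" "2 \<le> j" using n by (cases i) auto
      have "r (Suc j) * s (n - j) \<le> 4096 * r j * s (n - j)"
        by (rule mult_right_mono[OF r[OF j(2)]]) simp
      also have "\<dots> \<le> ?a i + ?b i" using j by simp
      finally show ?thesis using j by simp
    qed
    then have "(\<Sum>i\<le>Suc n. r i * s (Suc n - i)) \<le> (\<Sum>i\<le>Suc n. ?a i + ?b i)"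
      by (intro sum_mono) auto
    also have "\<dots> = (\<Sum>i\<le>Suc n. ?a i) + (\<Sum>i\<le>Suc n. ?b i)" by (rule sum.distrib)
    also have "(\<Sum>i\<le>Suc n. ?a i) = K * (\<Sum>i\<le>n. r i * s (n - i))"
      by (simp add: sum_distrib_left)
    also have "(\<Sum>i\<le>Suc n. ?b i) = 4096 * (\<Sum>i\<le>n. r i * s (n - i))"
      by (subst sum.atMost_Suc_shift) (simp add: sum_distrib_left)
    finally show ?thesis by (simp add: card_sum_lists_Suc r_def s_def algebra_simps)
  qed
  then show ?case by blast
qed

lemma sphere_sum_norm: "sphere sum_norm k n = mset ` sum_lists k n"
proof
  show "sphere sum_norm k n \<subseteq> mset ` sum_lists k n"
  proof
    fix M assume M: "M \<in> sphere sum_norm k n"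
    obtain xs where "mset xs = M" using ex_mset by blast
    then show "M \<in> mset ` sum_lists k n" using M
      by (auto simp: sphere_def Xk_def sum_norm_def sum_lists_def sum_mset_sum_list simp flip: mset_map
          intro!: image_eqI[of _ _ xs])
  qed
qed (auto simp: sphere_def Xk_def sum_norm_def sum_lists_def sum_mset_sum_list simp flip: mset_map)

section \<open>Ordered tuples by largest size\<close>

definition diagram_ball :: "nat \<Rightarrow> diagram set" where
  "diagram_ball n = {d \<in> Xdiag. dsize d \<le> n}"

lemma diagram_ball_Suc: "diagram_ball (Suc n) = diagram_ball n \<union> diagrams (Suc n)"
  by (auto simp: diagram_ball_def diagrams_def)

lemma finite_diagram_ball [simp]: "finite (diagram_ball n)"
proof (induction n)
  case 0
  have "diagram_ball 0 = diagrams 0" by (auto simp: diagram_ball_def diagrams_def)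
  then show ?case by simp
next
  case (Suc n)
  then show ?case unfolding diagram_ball_Suc by simp
qed

lemma card_diagram_ball_Suc:
  assumes "2 \<le> n"
  shows "card (diagram_ball (Suc n)) \<le> 4097 * card (diagram_ball n)"
proof -
  have "card (diagram_ball (Suc n)) \<le> card (diagram_ball n) + card (diagrams (Suc n))"
    unfolding diagram_ball_Suc by (rule card_Un_le)
  also have "card (diagrams (Suc n)) \<le> 4096 * card (diagrams n)" by (rule card_diagrams_Suc[OF assms])
  also have "card (diagrams n) \<le> card (diagram_ball n)"
    by (rule card_mono[OF finite_diagram_ball]) (auto simp: diagram_ball_def diagrams_def)
  finally show ?thesis by simp
qed

definition ball_lists :: "nat \<Rightarrow> nat \<Rightarrow> diagram list set" where
  "ball_lists k n = {xs. set xs \<subseteq> diagram_ball n \<and> length xs = k}"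

lemma finite_ball_lists [simp]: "finite (ball_lists k n)"
  unfolding ball_lists_def by (rule finite_lists_length_eq) simp

lemma card_ball_lists: "card (ball_lists k n) = card (diagram_ball n) ^ k"
  unfolding ball_lists_def by (rule card_lists_length_eq) simp

lemma sphere_max_norm_subset:
  "sphere max_norm (Suc k) n \<subseteq> mset ` (\<lambda>(d, ys). d # ys) ` (diagrams n \<times> ball_lists k n)"
proof
  fix M assume M: "M \<in> sphere max_norm (Suc k) n"
  then have ne: "set_mset M \<noteq> {}" by (auto simp: sphere_def Xk_def)
  then have "Max (dsize ` set_mset M) \<in> dsize ` set_mset M" by (intro Max_in) auto
  then obtain d where d: "d \<in># M" "dsize d = n" using M by (auto simp: sphere_def max_norm_def)
  then obtain N where N: "M = add_mset d N" by (meson mset_add)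
  obtain ys where ys: "mset ys = N" using ex_mset by blast
  have "dsize e \<le> n" if "e \<in># M" for e
    using M that by (auto simp: sphere_def max_norm_def)
  then have "d \<in> diagrams n" "ys \<in> ball_lists k n"
    using M d N ys by (auto simp: sphere_def Xk_def diagrams_def ball_lists_def diagram_ball_def
        simp flip: set_mset_mset size_mset)
  then show "M \<in> mset ` (\<lambda>(d, ys). d # ys) ` (diagrams n \<times> ball_lists k n)"
    using N ys by (auto intro!: image_eqI[of _ _ "d # ys"])
qed

lemma finite_sphere_sum [simp]: "finite (sphere sum_norm k n)"
  by (simp add: sphere_sum_norm)

lemma finite_sphere_max [simp]: "finite (sphere max_norm (Suc k) n)"
  by (rule finite_subset[OF sphere_max_norm_subset]) auto

lemma mset_in_sphere_max:
  assumes "d \<in> diagrams n" "set ys \<subseteq> diagram_ball n"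
  shows "mset (d # ys) \<in> sphere max_norm (Suc (length ys)) n"
proof -
  have "Max (insert (dsize d) (dsize ` set ys)) = n"
    using assms by (intro Max_eqI) (auto simp: diagrams_def diagram_ball_def)
  then show ?thesis
    using assms by (auto simp: sphere_def Xk_def max_norm_def diagrams_def diagram_ball_def)
qed

text \<open>The whole interface between counting and group theory: two injections that hide an
  arbitrary diagram and raise its size by a constant. The values 4 and 3 are the numbers of carets
  added by the two grafts constructed at the end.\<close>

locale grafting =
  fixes F G :: "diagram \<Rightarrow> diagram"
  assumes F: "d \<in> Xdiag \<Longrightarrow> F d \<in> Xdiag" "d \<in> Xdiag \<Longrightarrow> dsize (F d) = dsize d + 4" "inj F"
    and G: "d \<in> Xdiag \<Longrightarrow> G d \<in> Xdiag" "d \<in> Xdiag \<Longrightarrow> dsize (G d) = dsize d + 3" "inj G"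
begin

text \<open>Every integer from 6 on is a sum of threes and fours, so iterated grafting starting from
  the trivial diagram reaches every such size.\<close>

lemma diagrams_nonempty: "6 \<le> n \<Longrightarrow> diagrams n \<noteq> {}"
proof (induction n rule: less_induct)
  case (less n)
  have step: "diagrams (m + 3) \<noteq> {}" "diagrams (m + 4) \<noteq> {}" if ne: "diagrams m \<noteq> {}" for m
  proof -
    obtain d where "d \<in> diagrams m" using ne by blast
    then have "G d \<in> diagrams (m + 3)" "F d \<in> diagrams (m + 4)"
      using F(1,2) G(1,2) by (auto simp: diagrams_def)
    then show "diagrams (m + 3) \<noteq> {}" "diagrams (m + 4) \<noteq> {}" by blast+
  qed
  have "(Leaf, Leaf) \<in> diagrams 0" by (simp add: mem_diagrams)
  then have 0: "diagrams 0 \<noteq> {}" by blast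
  consider "n = 6" | "n = 7" | "n = 8" | "9 \<le> n" using less.prems by linarith
  then show ?case
  proof cases
    case 4
    then show ?thesis using less.IH[of "n - 3"] step(1)[of "n - 3"] by simp
  qed (use step(1)[OF step(1)[OF 0]] step(1)[OF step(2)[OF 0]] step(2)[OF step(2)[OF 0]] in simp_all)
qed

lemma inj_graft: "inj (\<lambda>(a, b, ys). F a # G b # ys)"
  using F(3) G(3) by (auto simp: inj_def)

text \<open>Grafting the first two entries embeds the ordered tuples of total \<open>n\<close> into
  ordered good tuples of total \<open>n + 7\<close>. Passing to multisets loses at most a factor
  \<open>fact ?k\<close>, and the shift by 7 = 4 + 3 costs at most \<open>K ^ 7\<close>.\<close>

lemma positive_density_sum_norm:
  assumes "\<And>a b ys. \<lbrakk>a \<in> Xdiag; b \<in> Xdiag; set ys \<subseteq> Xdiag; length ys = k\<rbrakk> \<Longrightarrow>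
     mset (F a # G b # ys) \<in> T"
  shows "positive_density sum_norm (k + 2) T"
proof -
  let ?k = "k + 2"
  obtain K where "\<forall>n \<ge> 2 * ?k. card (sum_lists ?k (Suc n)) \<le> K * card (sum_lists ?k n)"
    using card_sum_lists_ratio by blast
  then have K: "card (sum_lists ?k (n + 7)) \<le> K ^ 7 * card (sum_lists ?k n)" if "2 * ?k \<le> n" for n
    using ratio_iterate[where s = "\<lambda>n. card (sum_lists ?k n)", OF _ that, of K 7] by blast
  let ?g = "\<lambda>(a, b, ys). F a # G b # ys"
  have le: "card (sum_lists ?k n) \<le> fact ?k * card (T \<inter> sphere sum_norm ?k (n + 7))" for n
  proof -
    let ?S = "(\<lambda>(a, b, ys). a # b # ys) -` sum_lists ?k n"
    have inj: "inj (\<lambda>(a, b, ys). a # b # ys)" by (auto simp: inj_def)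
    have eq: "sum_lists ?k n = (\<lambda>(a, b, ys). a # b # ys) ` ?S"
    proof
      show "sum_lists ?k n \<subseteq> (\<lambda>(a, b, ys). a # b # ys) ` ?S"
      proof
        fix xs assume xs: "xs \<in> sum_lists ?k n"
        then obtain a b ys where "xs = a # b # ys"
          by (auto simp: sum_lists_def length_Suc_conv)
        then show "xs \<in> (\<lambda>(a, b, ys). a # b # ys) ` ?S"
          using xs by (intro image_eqI[of _ _ "(a, b, ys)"]) auto
      qed
    qed auto
    have fin: "finite ?S" using inj by (intro finite_vimageI) auto
    have "card (sum_lists ?k n) = card ?S"
      by (subst eq) (rule card_image[OF inj_on_subset[OF inj]], simp)
    also have "\<dots> = card (?g ` ?S)"
      by (rule card_image[OF inj_on_subset[OF inj_graft], symmetric]) simp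
    also have "\<dots> \<le> fact ?k * card (mset ` ?g ` ?S)"
      using fin by (intro card_lists_le_mset) (auto simp: sum_lists_def)
    also have "mset ` ?g ` ?S \<subseteq> T \<inter> sphere sum_norm ?k (n + 7)"
      unfolding sphere_sum_norm
    proof safe
      fix a b ys assume "a # b # ys \<in> sum_lists ?k n"
      then have "a \<in> Xdiag" "b \<in> Xdiag" "set ys \<subseteq> Xdiag" "length ys = k"
        "dsize a + dsize b + sum_list (map dsize ys) = n"
        by (auto simp: sum_lists_def)
      then show "mset (F a # G b # ys) \<in> T"
        and "mset (F a # G b # ys) \<in> mset ` sum_lists ?k (n + 7)"
        using assms F G by (auto simp: sum_lists_def intro!: imageI simp del: mset.simps)
    qed
    then have "card (mset ` ?g ` ?S) \<le> card (T \<inter> sphere sum_norm ?k (n + 7))"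
      by (intro card_mono) auto
    finally show ?thesis by simp
  qed
  show ?thesis
  proof (rule positive_densityI)
    \<comment> \<open>13 = 7 + 6: after the shift by 7, the ratio bound needs
      \<open>2 * ?k \<le> m\<close> and the existence of diagrams needs
      \<open>6 \<le> m\<close>.\<close>
    fix n assume n: "2 * ?k + 13 \<le> n"
    define m where "m = n - 7"
    have m: "n = m + 7" "2 * ?k \<le> m" "6 \<le> m" using n by (auto simp: m_def)
    have "card (sphere sum_norm ?k n) \<le> card (sum_lists ?k n)"
      unfolding sphere_sum_norm by (rule card_image_le) simp
    also have "\<dots> \<le> K ^ 7 * card (sum_lists ?k m)" using K[OF m(2)] m(1) by simp
    also have "\<dots> \<le> K ^ 7 * (fact ?k * card (T \<inter> sphere sum_norm ?k n))"
      using le[of m] m(1) by (intro mult_left_mono) auto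
    finally show "card (sphere sum_norm ?k n) \<le> (K ^ 7 * fact ?k) * card (T \<inter> sphere sum_norm ?k n)"
      by (simp add: mult.assoc)
    obtain d where "d \<in> diagrams m" using diagrams_nonempty[OF m(3)] by blast
    then have "d # replicate (k + 1) (Leaf, Leaf) \<in> sum_lists ?k m"
      by (auto simp: sum_lists_def diagrams_def dsize_def Xdiag_def reduced_def sum_list_replicate)
    then have "0 < card (sum_lists ?k m)" by (auto simp: card_gt_0_iff)
    then have "0 < card (T \<inter> sphere sum_norm ?k n)" using le[of m] m(1) by (auto intro: gr0I)
    then show "0 < card (sphere sum_norm ?k n)"
      by (meson card_mono finite_sphere_sum inf_le2 less_le_trans)
  qed
qed

text \<open>An entry \<open>a\<close> of size exactly \<open>n\<close> becomes one of size
  \<open>n + 4\<close>, which attains the maximum since the second graft has size at most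
  \<open>n + 3\<close>. The other \<open>k\<close> entries already range over the ball of radius
  \<open>n + 4\<close>, so only two factors have to be shifted and the loss does not grow with
  them.\<close>

lemma positive_density_max_norm:
  assumes "\<And>a b ys. \<lbrakk>a \<in> Xdiag; b \<in> Xdiag; set ys \<subseteq> Xdiag; length ys = k\<rbrakk> \<Longrightarrow>
     mset (F a # G b # ys) \<in> T"
  shows "positive_density max_norm (k + 2) T"
proof -
  let ?k = "k + 2"
  let ?g = "\<lambda>(a, b, ys). F a # G b # ys"
  have le: "card (diagrams n) * (card (diagram_ball n) * card (diagram_ball (n + 4)) ^ k) \<le>
      fact ?k * card (T \<inter> sphere max_norm ?k (n + 4))" for n
  proof -
    let ?S = "diagrams n \<times> diagram_ball n \<times> ball_lists k (n + 4)"
    have fin: "finite ?S" by simp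
    have "card (diagrams n) * (card (diagram_ball n) * card (diagram_ball (n + 4)) ^ k) = card ?S"
      by (simp add: card_cartesian_product card_ball_lists)
    also have "\<dots> = card (?g ` ?S)"
      by (rule card_image[OF inj_on_subset[OF inj_graft], symmetric]) simp
    also have "\<dots> \<le> fact ?k * card (mset ` ?g ` ?S)"
      by (rule card_lists_le_mset[OF finite_imageI[OF fin]]) (auto simp: ball_lists_def)
    also have "mset ` ?g ` ?S \<subseteq> T \<inter> sphere max_norm ?k (n + 4)"
    proof safe
      fix a b ys assume "a \<in> diagrams n" "b \<in> diagram_ball n" "ys \<in> ball_lists k (n + 4)"
      then have *: "a \<in> Xdiag" "b \<in> Xdiag" "set ys \<subseteq> Xdiag" "length ys = k"
        "dsize a = n" "dsize b \<le> n" "set ys \<subseteq> diagram_ball (n + 4)"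
        by (auto simp: diagrams_def ball_lists_def diagram_ball_def)
      show "mset (F a # G b # ys) \<in> T" using * assms by blast
      have "F a \<in> diagrams (n + 4)" "set (G b # ys) \<subseteq> diagram_ball (n + 4)"
        using * F G by (auto simp: diagrams_def diagram_ball_def)
      then show "mset (F a # G b # ys) \<in> sphere max_norm ?k (n + 4)"
        using mset_in_sphere_max[of "F a" "n + 4" "G b # ys"] * by simp
    qed
    then have "card (mset ` ?g ` ?S) \<le> card (T \<inter> sphere max_norm ?k (n + 4))"
      by (intro card_mono) auto
    finally show ?thesis by simp
  qed
  show ?thesis
  proof (rule positive_densityI)
    fix n assume n: "10 \<le> (n::nat)"
    define m where "m = n - 4"
    have m: "n = m + 4" "2 \<le> m" "6 \<le> m" using n by (auto simp: m_def)
    have r: "card (diagrams n) \<le> 4096 ^ 4 * card (diagrams m)"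
      unfolding m(1) by (rule ratio_iterate[where s = "\<lambda>n. card (diagrams n)", OF card_diagrams_Suc m(2)])
    have b: "card (diagram_ball n) \<le> 4097 ^ 4 * card (diagram_ball m)"
      unfolding m(1) by (rule ratio_iterate[where s = "\<lambda>n. card (diagram_ball n)", OF card_diagram_ball_Suc m(2)])
    have "card (sphere max_norm ?k n) \<le> card (mset ` (\<lambda>(d, ys). d # ys) ` (diagrams n \<times> ball_lists (k + 1) n))"
      using sphere_max_norm_subset[of "k + 1" n] by (intro card_mono) auto
    also have "\<dots> \<le> card (diagrams n \<times> ball_lists (k + 1) n)"
      by (rule order_trans[OF card_image_le card_image_le]) auto
    also have "\<dots> = card (diagrams n) * (card (diagram_ball n) * card (diagram_ball n) ^ k)"
      by (simp add: card_cartesian_product card_ball_lists)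
    also have "\<dots> \<le> (4096 ^ 4 * card (diagrams m)) * ((4097 ^ 4 * card (diagram_ball m)) * card (diagram_ball n) ^ k)"
      by (intro mult_mono r b) auto
    also have "\<dots> = 4096 ^ 4 * 4097 ^ 4 * (card (diagrams m) * (card (diagram_ball m) * card (diagram_ball n) ^ k))"
      by (simp only: ac_simps)
    also have "\<dots> \<le> 4096 ^ 4 * 4097 ^ 4 * (fact ?k * card (T \<inter> sphere max_norm ?k n))"
      using le[of m] m(1) by (intro mult_left_mono) auto
    finally show "card (sphere max_norm ?k n) \<le>
        (4096 ^ 4 * 4097 ^ 4 * fact ?k) * card (T \<inter> sphere max_norm ?k n)"
      by (simp only: mult.assoc)
    have "0 < card (diagrams m)" using diagrams_nonempty[OF m(3)] by (simp add: card_gt_0_iff)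
    moreover have "(Leaf, Leaf) \<in> diagram_ball i" for i
      by (simp add: diagram_ball_def dsize_def Xdiag_def reduced_def)
    then have "0 < card (diagram_ball i)" for i by (auto simp: card_gt_0_iff)
    ultimately have "0 < card (diagrams m) * (card (diagram_ball m) * card (diagram_ball (m + 4)) ^ k)" by simp
    then have "0 < card (T \<inter> sphere max_norm ?k n)"
      using le[of m] m(1) by (intro gr0I) auto
    moreover have "card (T \<inter> sphere max_norm ?k n) \<le> card (sphere max_norm ?k n)"
      using finite_sphere_max[of "k + 1" n] by (intro card_mono) auto
    ultimately show "0 < card (sphere max_norm ?k n)" by linarith
  qed
qed

end

subsection \<open>Maps that are affine on the leaves of a tree\<close>

definition affine_on :: "(real \<Rightarrow> real) \<Rightarrow> real \<times> real \<Rightarrow> real \<times> real \<Rightarrow> bool" where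
  "affine_on h I J \<longleftrightarrow> (\<forall>x. fst I \<le> x \<and> x \<le> snd I \<longrightarrow>
     h x = fst J + (snd J - fst J) / (snd I - fst I) * (x - fst I))"

lemma affine_onD:
  "affine_on h (p, q) (r, s) \<Longrightarrow> p \<le> x \<Longrightarrow> x \<le> q \<Longrightarrow> h x = r + (s - r) / (q - p) * (x - p)"
  by (simp add: affine_on_def)

lemma affine_on_cong:
  "(\<And>x. fst I \<le> x \<Longrightarrow> x \<le> snd I \<Longrightarrow> h x = h' x) \<Longrightarrow> affine_on h I J = affine_on h' I J"
  by (auto simp: affine_on_def)

lemma affine_on_ends:
  assumes "affine_on h (p, q) (r, s)" "p < q"
  shows "h p = r" "h q = s"
  using assms by (auto simp: affine_on_def)

lemma affine_on_bounds:
  assumes "affine_on h (p, q) (r, s)" "p < q" "r < s" "p \<le> x" "x \<le> q"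
  shows "r \<le> h x" "h x \<le> s"
proof -
  have "h x = r + (s - r) * ((x - p) / (q - p))"
    using affine_onD[OF assms(1,4,5)] by simp
  moreover have "0 \<le> (x - p) / (q - p)" "(x - p) / (q - p) \<le> 1" using assms by auto
  ultimately show "r \<le> h x" "h x \<le> s"
    using assms(3) mult_left_mono[of "(x - p) / (q - p)" 1 "s - r"]
      mult_nonneg_nonneg[of "s - r" "(x - p) / (q - p)"] by auto
qed

lemma affine_on_comp:
  assumes "affine_on h (p, q) (r, s)" "affine_on h' (r, s) J" "p < q" "r < s"
  shows "affine_on (h' \<circ> h) (p, q) J"
proof -
  obtain t u where J: "J = (t, u)" by (cases J)
  have "h' (h x) = t + (u - t) / (q - p) * (x - p)" if "p \<le> x" "x \<le> q" for x
    using affine_onD[OF assms(1) that] assms(3,4)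
      affine_onD[OF assms(2)[unfolded J] affine_on_bounds[OF assms(1,3,4) that]] by simp
  then show ?thesis by (simp add: affine_on_def J)
qed

lemma affine_on_inverse:
  assumes "affine_on h (p, q) (r, s)" "p < q" "r < s" "\<And>x. h' (h x) = x"
  shows "affine_on h' (r, s) (p, q)"
proof -
  have "h' y = p + (q - p) / (s - r) * (y - r)" if y: "r \<le> y" "y \<le> s" for y
  proof -
    define x where "x = p + (q - p) * ((y - r) / (s - r))"
    have "0 \<le> (y - r) / (s - r)" "(y - r) / (s - r) \<le> 1" using assms(3) y by auto
    then have "p \<le> x" "x \<le> q"
      using assms(2) mult_left_mono[of "(y - r) / (s - r)" 1 "q - p"]
        mult_nonneg_nonneg[of "q - p" "(y - r) / (s - r)"] by (auto simp: x_def)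
    then have "h x = r + (s - r) / (q - p) * (x - p)" by (rule affine_onD[OF assms(1)])
    also have "\<dots> = y" using assms(2,3) by (simp add: x_def)
    finally show ?thesis using assms(4)[of x] by (simp add: x_def)
  qed
  then show ?thesis by (simp add: affine_on_def)
qed

lemma affine_on_halves:
  assumes "affine_on h (a, b) (c, d)" "a < b"
  shows "affine_on h (a, (a + b) / 2) (c, (c + d) / 2)"
    and "affine_on h ((a + b) / 2, b) ((c + d) / 2, d)"
proof -
  have m: "((c + d) / 2 - c) / ((a + b) / 2 - a) = (d - c) / (b - a)"
    "(d - (c + d) / 2) / (b - (a + b) / 2) = (d - c) / (b - a)"
    using assms(2) by (simp_all add: divide_simps) (simp_all add: algebra_simps)
  have "c + (d - c) / (b - a) * (x - a) =
      (c + d) / 2 + (d - c) / (b - a) * (x - (a + b) / 2)" for x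
    using assms(2) by (simp add: divide_simps) (simp add: algebra_simps)
  then have "h x = (c + d) / 2 + (d - c) / (b - a) * (x - (a + b) / 2)" if "a \<le> x" "x \<le> b" for x
    using affine_onD[OF assms(1) that] by simp
  then show "affine_on h (a, (a + b) / 2) (c, (c + d) / 2)"
    and "affine_on h ((a + b) / 2, b) ((c + d) / 2, d)"
    using assms affine_onD[OF assms(1)] unfolding affine_on_def fst_conv snd_conv m by auto
qed

subsection \<open>Partitions of an interval\<close>

fun contiguous :: "real \<Rightarrow> (real \<times> real) list \<Rightarrow> real \<Rightarrow> bool" where
  "contiguous a [] b \<longleftrightarrow> a = b"
| "contiguous a ((p, q) # L) b \<longleftrightarrow> p = a \<and> p < q \<and> contiguous q L b"

lemma contiguous_append:
  "contiguous a (L @ M) b \<longleftrightarrow> (\<exists>m. contiguous a L m \<and> contiguous m M b)"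
  by (induction L arbitrary: a) auto

lemma contiguous_intervals: "a < b \<Longrightarrow> contiguous a (intervals S a b) b"
proof (induction S arbitrary: a b)
  case (Caret l r)
  then show ?case by (auto simp: contiguous_append intro!: exI[of _ "(a + b) / 2"])
qed auto

lemma contiguous_le: "contiguous a L b \<Longrightarrow> a \<le> b"
  by (induction L arbitrary: a) force+

lemma contiguous_mem: "contiguous a L b \<Longrightarrow> (p, q) \<in> set L \<Longrightarrow> a \<le> p \<and> p < q \<and> q \<le> b"
  by (induction L arbitrary: a) (auto dest: contiguous_le, fastforce)

lemma contiguous_cover:
  "contiguous a L b \<Longrightarrow> a < b \<Longrightarrow> a \<le> x \<Longrightarrow> x \<le> b \<Longrightarrow>
     \<exists>i < length L. fst (L ! i) \<le> x \<and> x \<le> snd (L ! i)"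
proof (induction L arbitrary: a)
  case (Cons I L)
  obtain p q where I: "I = (p, q)" by (cases I)
  show ?case
  proof (cases "x \<le> q")
    case True
    then show ?thesis using Cons.prems I by (intro exI[of _ 0]) auto
  next
    case False
    then have "\<exists>i < length L. fst (L ! i) \<le> x \<and> x \<le> snd (L ! i)"
      using Cons.prems I by (intro Cons.IH[of q]) auto
    then show ?thesis by auto
  qed
qed auto

lemma contiguous_split:
  "contiguous a L b \<Longrightarrow> a \<le> m \<Longrightarrow> m \<le> b \<Longrightarrow> (\<And>p q. (p, q) \<in> set L \<Longrightarrow> \<not> (p < m \<and> m < q)) \<Longrightarrow>
     \<exists>L1 L2. L = L1 @ L2 \<and> contiguous a L1 m \<and> contiguous m L2 b"
proof (induction L arbitrary: a)
  case (Cons I L)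
  obtain p q where I: "I = (p, q)" by (cases I)
  show ?case
  proof (cases "m = a")
    case True
    then show ?thesis using Cons.prems by (intro exI[of _ "[]"] exI[of _ "I # L"]) auto
  next
    case False
    then have "q \<le> m" using Cons.prems(1,2) Cons.prems(4)[of p q] I by auto
    then obtain L1 L2 where "L = L1 @ L2" "contiguous q L1 m" "contiguous m L2 b"
      using Cons.IH[of q] Cons.prems I by auto
    then show ?thesis using Cons.prems(1) I by (intro exI[of _ "I # L1"] exI[of _ L2]) auto
  qed
qed auto

lemma contiguous_whole:
  assumes "contiguous a L b" "(a, b) \<in> set L"
  shows "L = [(a, b)]"
proof -
  obtain M N where L: "L = M @ (a, b) # N" using assms(2) by (meson split_list)
  then have "contiguous a M a" "contiguous b N b"
    using assms(1) by (auto simp: contiguous_append)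
  moreover have "K = []" if "contiguous c K c" for c K
    using that contiguous_le by (cases K) (auto, fastforce)
  ultimately show ?thesis using L by auto
qed

lemma contiguous_map:
  "contiguous a L b \<Longrightarrow> (\<And>p q. (p, q) \<in> set L \<Longrightarrow> h p < h q) \<Longrightarrow>
     contiguous (h a) (map (\<lambda>I. (h (fst I), h (snd I))) L) (h b)"
  by (induction L arbitrary: a) auto

lemma contiguous_endpoints:
  assumes "contiguous a L b"
  shows "sorted_wrt (<) (a # map snd L)" "last (a # map snd L) = b"
    and "i < length L \<Longrightarrow> (a # map snd L) ! i = fst (L ! i)"
proof -
  show "sorted_wrt (<) (a # map snd L)"
    using assms
  proof (induction L arbitrary: a)
    case (Cons I L)
    then show ?case by (cases I) (fastforce dest: contiguous_mem)
  qed auto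
  show "last (a # map snd L) = b"
    using assms by (induction L arbitrary: a) auto
  show "(a # map snd L) ! i = fst (L ! i)" if "i < length L"
    using assms that
  proof (induction L arbitrary: a i)
    case (Cons I L)
    then show ?case by (cases I; cases i) auto
  qed auto
qed

lemma length_intervals [simp]: "length (intervals S a b) = nleaves S"
  by (induction S arbitrary: a b) auto

text \<open>The first piece containing a point decides its value, so at a common endpoint the later
  piece is overruled. The second conjunct, the value at the left end, shows that both pieces agree
  there.\<close>

lemma apply_pieces_affine:
  assumes "contiguous a L b" "contiguous c M d" "length L = length M"
  shows "list_all2 (affine_on (apply_pieces (zip L M))) L M \<and>
    (L \<noteq> [] \<longrightarrow> apply_pieces (zip L M) a = c)"
  using assms(3,1,2)
proof (induction L M arbitrary: a c rule: list_induct2)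
  case (Cons I L J M)
  obtain p q r s where IJ: "I = (p, q)" "J = (r, s)" by (cases I, cases J)
  let ?h = "apply_pieces (zip L M)" and ?H = "apply_pieces (zip (I # L) (J # M))"
  have c: "p = a" "a < q" "contiguous q L b" "r = c" "c < s" "contiguous s M d"
    using Cons.prems IJ by auto
  have IH: "list_all2 (affine_on ?h) L M" "L \<noteq> [] \<Longrightarrow> ?h q = s"
    using Cons.IH[OF c(3,6)] by auto
  have "affine_on ?H K K'" if K: "K \<in> set L" "affine_on ?h K K'" for K K'
  proof -
    have "q \<le> fst K" using contiguous_mem[OF c(3), of "fst K" "snd K"] K by simp
    moreover have "L \<noteq> []" using K by auto
    then have "?h q = s" by (rule IH(2))
    ultimately have "?H x = ?h x" if "fst K \<le> x" for x
      using that c by (cases "x = q") (auto simp: IJ)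
    then show ?thesis using K(2) by (subst affine_on_cong[of K ?H ?h]) auto
  qed
  then have "list_all2 (affine_on ?H) L M"
    using IH(1) by (auto simp: list_all2_conv_all_nth)
  moreover have "affine_on ?H I J" by (auto simp: affine_on_def IJ)
  moreover have "?H a = c" using c by (simp add: IJ)
  ultimately show ?case by (simp del: apply_pieces.simps zip_Cons_Cons)
qed auto

lemma apply_pieces_outside:
  "contiguous a L b \<Longrightarrow> x < a \<or> b < x \<Longrightarrow> apply_pieces (zip L M) x = x"
proof (induction L arbitrary: a M)
  case (Cons I L)
  obtain p q where I: "I = (p, q)" by (cases I)
  show ?case
  proof (cases M)
    case (Cons J M')
    obtain r s where "J = (r, s)" by (cases J)
    then show ?thesis using Cons.prems Cons.IH[of q M'] contiguous_le[of q L b] I \<open>M = _\<close> by auto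
  qed simp
qed simp

text \<open>A tree diagram, not necessarily reduced, for the restriction of \<open>h\<close> to a
  map from [a, b] onto [c, d]. Arbitrary base intervals allow the parts of a diagram to be treated
  separately.\<close>

definition carries :: "(real \<Rightarrow> real) \<Rightarrow> tree \<Rightarrow> real \<Rightarrow> real \<Rightarrow> tree \<Rightarrow> real \<Rightarrow> real \<Rightarrow> bool" where
  "carries h S a b T c d \<longleftrightarrow> list_all2 (affine_on h) (intervals S a b) (intervals T c d)"

lemma carries_nleaves: "carries h S a b T c d \<Longrightarrow> nleaves S = nleaves T"
  unfolding carries_def by (metis length_intervals list_all2_lengthD)

lemma carries_diagram_fun:
  assumes "nleaves S = nleaves T"
  shows "carries (diagram_fun (S, T)) S 0 1 T 0 1"
    and "x < 0 \<or> 1 < x \<Longrightarrow> diagram_fun (S, T) x = x"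
  using apply_pieces_affine[of 0 "intervals S 0 1" 1 0 "intervals T 0 1" 1]
    apply_pieces_outside[of 0 "intervals S 0 1" 1 x "intervals T 0 1"] assms
  by (auto simp: carries_def diagram_fun_def contiguous_intervals)

lemma interval_less: "a < b \<Longrightarrow> i < nleaves S \<Longrightarrow>
   fst (intervals S a b ! i) < snd (intervals S a b ! i)"
  using contiguous_mem[OF contiguous_intervals[of a b S],
      of "fst (intervals S a b ! i)" "snd (intervals S a b ! i)"] by simp

lemma carries_comp:
  assumes "carries h S a b T c d" "carries h' T c d U e f" "a < b" "c < d"
  shows "carries (h' \<circ> h) S a b U e f"
  unfolding carries_def list_all2_conv_all_nth
proof (intro conjI allI impI)
  show "length (intervals S a b) = length (intervals U e f)"
    using assms carries_nleaves by simp
  fix i assume "i < length (intervals S a b)"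
  then have i: "i < nleaves S" "i < nleaves T" using carries_nleaves[OF assms(1)] by simp_all
  then have "affine_on h (intervals S a b ! i) (intervals T c d ! i)"
    "affine_on h' (intervals T c d ! i) (intervals U e f ! i)"
    using assms by (auto simp: carries_def list_all2_conv_all_nth)
  then show "affine_on (h' \<circ> h) (intervals S a b ! i) (intervals U e f ! i)"
    using affine_on_comp interval_less[OF assms(3) i(1)] interval_less[OF assms(4) i(2)]
    by (metis prod.collapse)
qed

lemma carries_inverse:
  assumes "carries h S a b T c d" "a < b" "c < d" "\<And>x. h' (h x) = x"
  shows "carries h' T c d S a b"
  unfolding carries_def list_all2_conv_all_nth
proof (intro conjI allI impI)
  show "length (intervals T c d) = length (intervals S a b)"
    using assms carries_nleaves by simp
  fix i assume "i < length (intervals T c d)"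
  then have i: "i < nleaves S" "i < nleaves T" using carries_nleaves[OF assms(1)] by simp_all
  then have "affine_on h (intervals S a b ! i) (intervals T c d ! i)"
    using assms by (auto simp: carries_def list_all2_conv_all_nth)
  then show "affine_on h' (intervals T c d ! i) (intervals S a b ! i)"
    using affine_on_inverse assms(4) interval_less[OF assms(2) i(1)] interval_less[OF assms(3) i(2)]
    by (metis prod.collapse)
qed

lemma carries_affine:
  "affine_on h (a, b) (c, d) \<Longrightarrow> a < b \<Longrightarrow> carries h S a b S c d"
proof (induction S arbitrary: a b c d)
  case (Caret l r)
  then show ?case using affine_on_halves[OF Caret.prems]
    by (auto simp: carries_def intro!: list_all2_appendI)
qed (simp add: carries_def)

lemma carries_Caret:
  "carries h S a ((a + b) / 2) S' c ((c + d) / 2) \<Longrightarrow> carries h T ((a + b) / 2) b T' ((c + d) / 2) d \<Longrightarrow>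
     carries h (Caret S T) a b (Caret S' T') c d"
  by (auto simp: carries_def intro: list_all2_appendI)

lemma carries_eq:
  assumes "carries h S a b T c d" "carries h' S a b T c d" "a < b" "a \<le> x" "x \<le> b"
  shows "h x = h' x"
proof -
  obtain i where i: "i < nleaves S" "fst (intervals S a b ! i) \<le> x" "x \<le> snd (intervals S a b ! i)"
    using contiguous_cover[OF contiguous_intervals[OF assms(3), of S] assms(3,4,5)] by auto
  then show ?thesis using assms(1,2)
    by (auto simp: carries_def list_all2_conv_all_nth affine_on_def)
qed

lemma carries_bounds:
  assumes "carries h S a b T c d" "a < b" "c < d" "a \<le> x" "x \<le> b"
  shows "c \<le> h x" "h x \<le> d"
proof -
  obtain i where i: "i < nleaves S" "fst (intervals S a b ! i) \<le> x" "x \<le> snd (intervals S a b ! i)"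
    using contiguous_cover[OF contiguous_intervals[OF assms(2), of S] assms(2,4,5)] by auto
  obtain p q r s where pq: "intervals S a b ! i = (p, q)" "intervals T c d ! i = (r, s)"
    by (cases "intervals S a b ! i", cases "intervals T c d ! i")
  have i': "i < nleaves T" using i carries_nleaves[OF assms(1)] by simp
  have "affine_on h (p, q) (r, s)" using assms(1) i
    unfolding pq[symmetric] by (auto simp: carries_def list_all2_conv_all_nth)
  moreover have "p < q" "r < s" "c \<le> r" "s \<le> d"
    using interval_less[OF assms(2) i(1)] interval_less[OF assms(3) i'] pq
      contiguous_mem[OF contiguous_intervals[OF assms(3)], of r s T] nth_mem[of i "intervals T c d"] i'
    by auto
  ultimately show "c \<le> h x" "h x \<le> d"
    using affine_on_bounds[of h p q r s x] i pq by auto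
qed

subsection \<open>Dyadic intervals and tree pairs for elements of F\<close>

definition cell :: "nat \<Rightarrow> int \<Rightarrow> real \<times> real" where
  "cell N j = (of_int j / 2 ^ N, (of_int j + 1) / 2 ^ N)"

lemma cell_less: "fst (cell N j) < snd (cell N j)"
  by (simp add: cell_def divide_strict_right_mono)

lemma cell_halves:
  assumes "cell N j = (p, q)"
  shows "cell (Suc N) (2 * j) = (p, (p + q) / 2)" "cell (Suc N) (2 * j + 1) = ((p + q) / 2, q)"
  using assms by (auto simp: cell_def field_simps)

text \<open>The midpoint of a level \<open>m\<close> cell is a multiple of \<open>1 / 2 ^ N\<close>
  for every \<open>N > m\<close>, so it is not interior to any finer cell; and a cell of level at
  most \<open>m\<close> is long enough to fill the given one.\<close>

lemma cell_straddle:
  assumes "cell m a = (p, q)" "cell N j = (r, s)" "p \<le> r" "s \<le> q" "r < (p + q) / 2" "(p + q) / 2 < s"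
  shows "r = p \<and> s = q"
proof (cases "N \<le> m")
  case True
  have "q - p \<le> s - r"
    using assms(1,2) True by (auto simp: cell_def diff_divide_distrib[symmetric] frac_le power_increasing)
  then show ?thesis using assms by auto
next
  case False
  define i where "i = (2 * a + 1) * 2 ^ (N - Suc m)"
  have "(2::real) ^ N = 2 * 2 ^ m * 2 ^ (N - Suc m)"
    using False by (simp flip: power_add power_Suc)
  then have "of_int i / 2 ^ N = (2 * of_int a + 1) / (2 * 2 ^ m :: real)" by (simp add: i_def)
  also have "\<dots> = (p + q) / 2" using assms(1) by (auto simp: cell_def add_divide_distrib)
  finally have "(p + q) / 2 = of_int i / 2 ^ N" ..
  then have "of_int j < (of_int i :: real)" "of_int i < (of_int j + 1 :: real)"
    using assms(2,5,6) by (auto simp: cell_def divide_less_cancel)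
  then have "j < i" "i < j + 1" by linarith+
  then show ?thesis by simp
qed

text \<open>Unless the partition consists of the whole interval, none of its cells straddles the
  midpoint. It therefore splits there, and the two halves supply the two subtrees.\<close>

lemma contiguous_cells_tree:
  assumes "contiguous p L q" "cell m a = (p, q)" "\<And>I. I \<in> set L \<Longrightarrow> \<exists>N j. I = cell N j"
  shows "\<exists>T. intervals T p q = L"
  using assms
proof (induction "length L" arbitrary: L p q m a rule: less_induct)
  case less
  have pq: "p < q" using cell_less[of m a] less.prems by simp
  show ?case
  proof (cases "(p, q) \<in> set L")
    case True
    then show ?thesis using contiguous_whole[OF less.prems(1)] by (intro exI[of _ Leaf]) simp
  next
    case False
    let ?m = "(p + q) / 2"
    have "\<not> (r < ?m \<and> ?m < s)" if rs: "(r, s) \<in> set L" for r s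
    proof
      assume m: "r < ?m \<and> ?m < s"
      obtain N j where "cell N j = (r, s)" using less.prems(3)[OF rs] by auto
      then have "r = p \<and> s = q"
        using cell_straddle[OF less.prems(2)] contiguous_mem[OF less.prems(1) rs] m by auto
      then show False using rs False by simp
    qed
    then obtain L1 L2 where L: "L = L1 @ L2" "contiguous p L1 ?m" "contiguous ?m L2 q"
      using contiguous_split[OF less.prems(1), of ?m] pq by auto
    then have "length L1 < length L" "length L2 < length L"
      using pq by (cases L1; cases L2; auto)+
    then obtain T1 T2 where "intervals T1 p ?m = L1" "intervals T2 ?m q = L2"
      using less.hyps[OF _ L(2) cell_halves(1)[OF less.prems(2)]]
        less.hyps[OF _ L(3) cell_halves(2)[OF less.prems(2)]] less.prems(3) L(1)
      by (metis Un_iff set_append)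
    then show ?thesis using L by (intro exI[of _ "Caret T1 T2"]) simp
  qed
qed

fun full_tree :: "nat \<Rightarrow> tree" where
  "full_tree 0 = Leaf"
| "full_tree (Suc n) = Caret (full_tree n) (full_tree n)"

lemma intervals_full_tree:
  "cell m a = (p, q) \<Longrightarrow> I \<in> set (intervals (full_tree n) p q) \<Longrightarrow> \<exists>j. I = cell (m + n) j"
proof (induction n arbitrary: m a p q)
  case 0
  then have "I = cell (m + 0) a" by simp
  then show ?case by blast
next
  case (Suc n)
  then show ?case
    using Suc.IH[OF cell_halves(1)[OF Suc.prems(1)]] Suc.IH[OF cell_halves(2)[OF Suc.prems(1)]]
    by auto
qed

lemma intervals_cell:
  "cell m a = (p, q) \<Longrightarrow> I \<in> set (intervals S p q) \<Longrightarrow> \<exists>N j. I = cell N j"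
proof (induction S arbitrary: m a p q)
  case Leaf
  then have "I = cell m a" by simp
  then show ?case by blast
next
  case (Caret l r)
  then show ?case
    using Caret.IH(1)[OF cell_halves(1)[OF Caret.prems(1)]]
      Caret.IH(2)[OF cell_halves(2)[OF Caret.prems(1)]] by auto
qed

text \<open>The bound M on the level of the image makes this property closed under composition.\<close>

definition cellular :: "(real \<Rightarrow> real) \<Rightarrow> bool" where
  "cellular h \<longleftrightarrow> (\<forall>M. \<exists>N0. \<forall>N\<ge>N0. \<forall>j. \<exists>N'\<ge>M. \<exists>j'. affine_on h (cell N j) (cell N' j'))"

definition fixes_outside :: "(real \<Rightarrow> real) \<Rightarrow> bool" where
  "fixes_outside h \<longleftrightarrow> (\<forall>x. x < 0 \<or> 1 < x \<longrightarrow> h x = x) \<and> h 0 = 0 \<and> h 1 = 1"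

lemma cellular_comp:
  assumes "cellular h" "cellular h'"
  shows "cellular (h' \<circ> h)"
  unfolding cellular_def
proof
  fix M
  obtain N1 where N1: "\<And>N j. N1 \<le> N \<Longrightarrow> \<exists>N'\<ge>M. \<exists>j'. affine_on h' (cell N j) (cell N' j')"
    using assms(2) unfolding cellular_def by meson
  obtain N0 where N0: "\<And>N j. N0 \<le> N \<Longrightarrow> \<exists>N'\<ge>N1. \<exists>j'. affine_on h (cell N j) (cell N' j')"
    using assms(1) unfolding cellular_def by meson
  have "\<exists>N'\<ge>M. \<exists>j'. affine_on (h' \<circ> h) (cell N j) (cell N' j')" if N: "N0 \<le> N" for N j
  proof -
    obtain N' j' where 1: "N1 \<le> N'" "affine_on h (cell N j) (cell N' j')" using N0[OF N] by blast
    obtain N'' j'' where 2: "M \<le> N''" "affine_on h' (cell N' j') (cell N'' j'')" using N1[OF 1(1)] by blast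
    have "affine_on (h' \<circ> h) (cell N j) (cell N'' j'')"
      using affine_on_comp[of h "fst (cell N j)" "snd (cell N j)" "fst (cell N' j')" "snd (cell N' j')" h']
        1 2 cell_less by simp
    then show ?thesis using 2(1) by blast
  qed
  then show "\<exists>N0. \<forall>N\<ge>N0. \<forall>j. \<exists>N'\<ge>M. \<exists>j'. affine_on (h' \<circ> h) (cell N j) (cell N' j')" by blast
qed

text \<open>A full domain tree of sufficient depth has only leaves that \<open>h\<close> maps
  affinely onto dyadic cells. The images are again contiguous, so they are the leaves of a range
  tree.\<close>

lemma cellular_carries:
  assumes "cellular h" "cell m a = (p, q)" "cell m' a' = (h p, h q)"
  obtains S T where "carries h S p q T (h p) (h q)"
proof -
  obtain N0 where N0: "\<And>N j. N0 \<le> N \<Longrightarrow> \<exists>N' j'. affine_on h (cell N j) (cell N' j')"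
    using assms(1) unfolding cellular_def by blast
  define S where "S = full_tree N0"
  have pq: "p < q" using cell_less[of m a] assms(2) by simp
  have img: "\<exists>N' j'. (h r, h s) = cell N' j' \<and> affine_on h (r, s) (h r, h s)"
    if rs: "(r, s) \<in> set (intervals S p q)" for r s
  proof -
    obtain j where j: "(r, s) = cell (m + N0) j"
      using intervals_full_tree[OF assms(2)] rs unfolding S_def by blast
    then obtain N' j' where N': "affine_on h (r, s) (cell N' j')" using N0[of "m + N0" j] by auto
    moreover have "r < s" using cell_less[of "m + N0" j] j[symmetric] by simp
    ultimately have "cell N' j' = (h r, h s)"
      using affine_on_ends[of h r s "fst (cell N' j')" "snd (cell N' j')"] by (simp add: prod_eq_iff)
    then show ?thesis using N' by metis
  qed
  have "h r < h s" if "(r, s) \<in> set (intervals S p q)" for r s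
    using img[OF that] cell_less by (metis fst_conv snd_conv)
  then have "contiguous (h p) (map (\<lambda>I. (h (fst I), h (snd I))) (intervals S p q)) (h q)"
    by (intro contiguous_map contiguous_intervals pq)
  then obtain T where T: "intervals T (h p) (h q) = map (\<lambda>I. (h (fst I), h (snd I))) (intervals S p q)"
    using contiguous_cells_tree[OF _ assms(3)] img by fastforce
  have "carries h S p q T (h p) (h q)"
    unfolding carries_def T
    using img by (auto simp: list_all2_conv_all_nth) (metis length_intervals nth_mem prod.collapse)
  then show ?thesis by (rule that)
qed

section \<open>Dyadic numbers, and tree diagrams for the elements of F\<close>

lemma dyadic_0: "dyadic 0" and dyadic_1: "dyadic 1"
  unfolding dyadic_def by (rule exI[of _ 0], simp) (rule exI[of _ 1], rule exI[of _ 0], simp)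

lemma dyadic_cell: "dyadic (fst (cell N j))" "dyadic (snd (cell N j))"
  unfolding dyadic_def cell_def
  by (rule exI[of _ j], rule exI[of _ N], simp) (rule exI[of _ "j + 1"], rule exI[of _ N], simp)

lemma dyadic_level: "dyadic x \<longleftrightarrow> (\<exists>m0. \<forall>m\<ge>m0. x * 2 ^ m \<in> \<int>)"
proof
  assume "dyadic x"
  then obtain a m0 where x: "x = of_int a / 2 ^ m0" unfolding dyadic_def by blast
  have "x * 2 ^ m \<in> \<int>" if "m0 \<le> m" for m
  proof -
    have "(2::real) ^ m = 2 ^ m0 * 2 ^ (m - m0)" using that by (simp flip: power_add)
    then have "x * 2 ^ m = of_int (a * 2 ^ (m - m0))" by (simp add: x)
    then show ?thesis by (metis Ints_of_int)
  qed
  then show "\<exists>m0. \<forall>m\<ge>m0. x * 2 ^ m \<in> \<int>" by blast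
next
  assume "\<exists>m0. \<forall>m\<ge>m0. x * 2 ^ m \<in> \<int>"
  then obtain m a where "x * 2 ^ m = of_int a" by (metis Ints_cases order_refl)
  then have "x = of_int a / 2 ^ m" by (simp add: field_simps)
  then show "dyadic x" unfolding dyadic_def by blast
qed

lemma dyadic_add: "dyadic x \<Longrightarrow> dyadic y \<Longrightarrow> dyadic (x + y)"
  and dyadic_diff: "dyadic x \<Longrightarrow> dyadic y \<Longrightarrow> dyadic (x - y)"
proof -
  assume "dyadic x" "dyadic y"
  then obtain m1 m2 where m: "\<forall>m\<ge>m1. x * 2 ^ m \<in> \<int>" "\<forall>m\<ge>m2. y * 2 ^ m \<in> \<int>"
    unfolding dyadic_level by blast
  then show "dyadic (x + y)" "dyadic (x - y)"
    unfolding dyadic_level by (auto intro!: exI[of _ "max m1 m2"] simp: algebra_simps)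
qed

lemma dyadic_mult: "dyadic x \<Longrightarrow> dyadic y \<Longrightarrow> dyadic (x * y)"
  unfolding dyadic_def by (metis of_int_mult power_add times_divide_times_eq)

lemma dyadic_powi: "dyadic (2 powi k)"
proof (cases "0 \<le> k")
  case True
  then have "(2::real) powi k = of_int (2 ^ nat k) / 2 ^ 0" by (simp add: power_int_def)
  then show ?thesis unfolding dyadic_def by blast
next
  case False
  then have "(2::real) powi k = of_int 1 / 2 ^ nat (-k)" by (simp add: power_int_def field_simps)
  then show ?thesis unfolding dyadic_def by blast
qed

lemma dyadic_common_level:
  assumes "finite A" "\<And>x. x \<in> A \<Longrightarrow> dyadic x"
  obtains m0 where "\<And>m x. m0 \<le> m \<Longrightarrow> x \<in> A \<Longrightarrow> x * 2 ^ m \<in> \<int>"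
proof -
  obtain F where F: "\<And>x m. x \<in> A \<Longrightarrow> F x \<le> m \<Longrightarrow> x * 2 ^ m \<in> \<int>"
    using assms(2) unfolding dyadic_level by metis
  have "x * 2 ^ m \<in> \<int>" if "Max (insert 0 (F ` A)) \<le> m" "x \<in> A" for m x
    using F[OF that(2)] that assms(1) by simp
  then show ?thesis using that by blast
qed

text \<open>Once the mesh divides all breakpoints, no cell of level \<open>N\<close> meets the
  interior of two pieces. On a piece of slope \<open>2 powi k\<close> its image has length
  \<open>1 / 2 ^ (N - k)\<close>, and it is a cell because the images of the breakpoints are
  multiples of that length.\<close>

lemma thompsonF_cellular:
  assumes "h \<in> thompsonF"
  shows "cellular h"
proof -
  obtain xs :: "real list" and ks :: "int list" where
    len: "length xs = length ks + 1" and xs0: "xs ! 0 = 0" and lastx: "last xs = 1" and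
    sorted: "sorted_wrt (<) xs" and dx: "\<And>x. x \<in> set xs \<Longrightarrow> dyadic x" and
    aff: "\<And>i x. i < length ks \<Longrightarrow> xs ! i \<le> x \<Longrightarrow> x \<le> xs ! (i+1) \<Longrightarrow>
            h x = h (xs ! i) + (2::real) powi (ks ! i) * (x - xs ! i)"
    and out: "\<And>x. x < 0 \<or> 1 < x \<Longrightarrow> h x = x" and h01: "h 0 = 0" "h 1 = 1"
    using assms unfolding thompsonF_def by blast
  have last1: "xs ! length ks = 1" using lastx len by (metis add_diff_cancel_right' last_conv_nth length_0_conv add_is_0 one_neq_zero)
  have inc: "xs ! i < xs ! j" if "i < j" "j < length xs" for i j
    using sorted that by (simp add: sorted_wrt_iff_nth_less)
  have dh: "dyadic (h (xs ! i))" if "i < length xs" for i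
    using that
  proof (induction i)
    case 0
    then show ?case by (simp add: xs0 h01 dyadic_0)
  next
    case (Suc i)
    then have "h (xs ! Suc i) = h (xs ! i) + 2 powi (ks ! i) * (xs ! Suc i - xs ! i)"
      using aff[of i "xs ! Suc i"] inc[of i "Suc i"] len by simp
    then show ?case using Suc dx by (auto intro!: dyadic_add dyadic_mult dyadic_powi dyadic_diff)
  qed
  have "\<And>x. x \<in> set xs \<union> h ` set xs \<Longrightarrow> dyadic x" using dx dh by (auto simp: in_set_conv_nth)
  then obtain m0 where m0: "\<And>m x. m0 \<le> m \<Longrightarrow> x \<in> set xs \<union> h ` set xs \<Longrightarrow> x * 2 ^ m \<in> \<int>"
    using dyadic_common_level[of "set xs \<union> h ` set xs"] by (metis finite_Un finite_imageI List.finite_set)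
  define K where "K = Max (insert 0 ((\<lambda>k. nat \<bar>k\<bar>) ` set ks))"
  have K: "\<bar>k\<bar> \<le> int K" if "k \<in> set ks" for k
  proof -
    have "nat \<bar>k\<bar> \<le> K" unfolding K_def using that by (intro Max_ge) auto
    then show ?thesis by linarith
  qed
  \<comment> \<open>\<open>m0\<close> is a level from which on all breakpoints and their images are
    integral, and \<open>K\<close> bounds the slope exponents. So the image level
    \<open>N - k\<close> is at least \<open>m0 + M\<close> as well.\<close>
  have "\<exists>N'\<ge>M. \<exists>j'. affine_on h (cell N j) (cell N' j')" if N: "m0 + K + M \<le> N" for M N j
  proof (cases "0 \<le> j \<and> j < 2 ^ N")
    case False
    have "h x = x" if "fst (cell N j) \<le> x" "x \<le> snd (cell N j)" for x
    proof -
      have "x \<le> 0 \<or> 1 \<le> x"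
      proof (cases "j < 0")
        case True
        then have "(of_int j + 1 :: real) \<le> 0" by linarith
        then have "snd (cell N j) \<le> 0" by (simp add: cell_def divide_le_0_iff)
        then show ?thesis using that by linarith
      next
        case f: False
        then have "(2 ^ N :: int) \<le> j" using False by simp
        then have "(2 ^ N :: real) \<le> of_int j" by (metis of_int_le_iff of_int_numeral of_int_power)
        then have "1 \<le> fst (cell N j)" by (simp add: cell_def)
        then show ?thesis using that by linarith
      qed
      then show ?thesis using out[of x] h01 by (cases "x = 0"; cases "x = 1") auto
    qed
    then have "affine_on h (cell N j) (cell N j)"
      using cell_less[of N j] by (auto simp: affine_on_def)
    then show ?thesis using N by (intro exI[of _ N]) auto
  next
    case True
    let ?y = "of_int j / 2 ^ N :: real"
    have "(of_int j :: real) < 2 ^ N" using True by (metis of_int_less_iff of_int_numeral of_int_power)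
    then have y: "0 \<le> ?y" "?y < 1" using True by auto
    define i where "i = Max {i. i < length xs \<and> xs ! i \<le> ?y}"
    let ?I = "{i. i < length xs \<and> xs ! i \<le> ?y}"
    have "0 \<in> ?I" using len xs0 y by simp
    then have "i \<in> ?I" unfolding i_def by (intro Max_in) auto
    then have i: "i < length xs" "xs ! i \<le> ?y" by auto
    have "i \<noteq> length ks" using i y last1 by auto
    then have ik: "i < length ks" using i len by simp
    have "Suc i \<notin> ?I"
      using Max_ge[of ?I "Suc i"] unfolding i_def[symmetric] by auto
    then have i2: "?y < xs ! Suc i" using ik len by auto
    obtain b where b: "xs ! Suc i * 2 ^ N = of_int b"
      using m0[of N "xs ! Suc i"] N ik len by (auto elim: Ints_cases)
    \<comment> \<open>Scaled by \<open>2 ^ N\<close>, the left end of the cell and the next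
      breakpoint are integers, so the strict inequality already places the right end before that
      breakpoint.\<close>
    have "of_int j < (of_int b :: real)" using i2 b by (simp add: field_simps)
    then have "j + 1 \<le> b" by linarith
    then have "real_of_int (j + 1) \<le> of_int b" by (simp only: of_int_le_iff)
    then have up: "(of_int j + 1) / 2 ^ N \<le> xs ! Suc i" using b by (simp add: field_simps)
    define k where "k = ks ! i"
    have k: "\<bar>k\<bar> \<le> int K" using K ik by (simp add: k_def)
    define N' where "N' = nat (int N - k)"
    have N': "int N' = int N - k" "m0 \<le> N'" "M \<le> N'" using k N by (auto simp: N'_def)
    have pw: "(2::real) ^ N' = 2 ^ N / 2 powi k"
    proof -
      have "(2::real) ^ N' = 2 powi (int N')" by simp
      also have "\<dots> = 2 ^ N / 2 powi k" unfolding N'(1) by (simp add: power_int_diff)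
      finally show ?thesis .
    qed
    obtain c where c: "h (xs ! i) * 2 ^ N' = of_int c"
      using m0[of N' "h (xs ! i)"] N' i by (auto elim: Ints_cases)
    obtain a where a: "xs ! i * 2 ^ N = of_int a"
      using m0[of N "xs ! i"] N i by (auto elim: Ints_cases)
    have a': "xs ! i = of_int a / 2 ^ N" using a by (simp add: field_simps)
    have c': "h (xs ! i) = of_int c / 2 ^ N'" using c by (simp add: field_simps)
    have "h x = of_int (c + (j - a)) / 2 ^ N' + 2 powi k * (x - ?y)"
      if "?y \<le> x" "x \<le> (of_int j + 1) / 2 ^ N" for x
    proof -
      have d: "x - xs ! i = of_int (j - a) / 2 ^ N + (x - ?y)"
        unfolding a' by (simp add: diff_divide_distrib)
      have "h x = h (xs ! i) + 2 powi k * (x - xs ! i)"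
        using aff[OF ik, of x] that i(2) up by (simp add: k_def)
      also have "\<dots> = of_int c / 2 ^ N' + 2 powi k * (of_int (j - a) / 2 ^ N) + 2 powi k * (x - ?y)"
        unfolding c' d by (simp only: distrib_left add.assoc)
      also have "2 powi k * (of_int (j - a) / 2 ^ N) = of_int (j - a) / (2 ^ N' :: real)"
        unfolding pw by simp
      finally show ?thesis by (simp add: add_divide_distrib)
    qed
    moreover have "((of_int j' + 1) / 2 ^ N' - of_int j' / 2 ^ N') /
        ((of_int j + 1) / 2 ^ N - of_int j / 2 ^ N) = (2::real) powi k" for j'
      unfolding pw by (simp add: diff_divide_distrib[symmetric]) (simp add: algebra_simps)
    ultimately have "affine_on h (cell N j) (cell N' (c + (j - a)))"
      unfolding affine_on_def cell_def fst_conv snd_conv by metis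
    then show ?thesis using N'(3) by blast
  qed
  then show ?thesis unfolding cellular_def by blast
qed

lemma cell_0_0: "cell 0 0 = (0, 1)"
  by (simp add: cell_def)

lemma carries_thompsonF:
  assumes "carries h S 0 1 T 0 1" "fixes_outside h"
  shows "h \<in> thompsonF"
proof -
  let ?L = "intervals S 0 1" and ?M = "intervals T 0 1"
  have "\<exists>k. (snd (?M ! i) - fst (?M ! i)) / (snd (?L ! i) - fst (?L ! i)) = 2 powi k"
    if "i < nleaves S" for i
  proof -
    have "?L ! i \<in> set ?L" "?M ! i \<in> set ?M" using that carries_nleaves[OF assms(1)] by auto
    then obtain N j N' j' where "?L ! i = cell N j" "?M ! i = cell N' j'"
      using intervals_cell[OF cell_0_0, of "?L ! i"] intervals_cell[OF cell_0_0, of "?M ! i"] by blast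
    then have "(snd (?M ! i) - fst (?M ! i)) / (snd (?L ! i) - fst (?L ! i)) = 2 powi (int N - int N')"
      by (simp add: cell_def diff_divide_distrib[symmetric] power_int_diff)
    then show ?thesis by blast
  qed
  then obtain k where k: "\<And>i. i < nleaves S \<Longrightarrow>
      (snd (?M ! i) - fst (?M ! i)) / (snd (?L ! i) - fst (?L ! i)) = 2 powi (k i)"
    by metis
  define xs where "xs = 0 # map snd ?L"
  define ks where "ks = map k [0..<nleaves S]"
  have ct: "contiguous 0 ?L 1" by (rule contiguous_intervals) simp
  have nth: "xs ! i = fst (?L ! i)" "xs ! (i + 1) = snd (?L ! i)" if "i < nleaves S" for i
    using that contiguous_endpoints(3)[OF ct, of i] by (auto simp: xs_def)
  have "dyadic (snd I)" if "I \<in> set ?L" for I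
    using intervals_cell[OF cell_0_0 that] dyadic_cell(2) by auto
  then have dyadics: "\<forall>x\<in>set xs. dyadic x"
    using dyadic_0 by (auto simp: xs_def)
  have pieces: "h x = h (xs ! i) + 2 powi (ks ! i) * (x - xs ! i)"
    if i: "i < nleaves S" and x: "xs ! i \<le> x" "x \<le> xs ! (i + 1)" for i x
  proof -
    have "affine_on h (?L ! i) (?M ! i)"
      using assms(1) i by (auto simp: carries_def list_all2_conv_all_nth)
    moreover have "fst (?L ! i) \<le> snd (?L ! i)" using x nth[OF i] by simp
    ultimately show ?thesis using x k[OF i] nth[OF i] i by (auto simp: affine_on_def ks_def)
  qed
  have lk: "length ks = nleaves S" by (simp add: ks_def)
  have "\<forall>i < length ks. \<forall>x. xs ! i \<le> x \<and> x \<le> xs ! (i+1) \<longrightarrow>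
      h x = h (xs ! i) + 2 powi (ks ! i) * (x - xs ! i)"
    unfolding lk by (intro allI impI pieces) auto
  moreover have "sorted_wrt (<) xs" "last xs = 1" "xs ! 0 = 0"
    using contiguous_endpoints[OF ct] by (simp_all add: xs_def)
  moreover have "length xs = length ks + 1" unfolding lk by (simp add: xs_def)
  ultimately show ?thesis
    using assms(2) dyadics unfolding thompsonF_def fixes_outside_def by blast
qed

lemma thompsonF_fixes_outside: "h \<in> thompsonF \<Longrightarrow> fixes_outside h"
  by (auto simp: thompsonF_def fixes_outside_def)

text \<open>Both conditions pass to composites directly, so closure under composition follows
  without a common refinement of two subdivisions.\<close>

lemma thompsonF_iff: "h \<in> thompsonF \<longleftrightarrow> cellular h \<and> fixes_outside h"
proof
  assume "cellular h \<and> fixes_outside h"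
  moreover from this have "h 0 = 0" "h 1 = 1" by (auto simp: fixes_outside_def)
  ultimately show "h \<in> thompsonF"
    using cellular_carries[of h 0 0 0 1 0 0] carries_thompsonF cell_0_0 by metis
qed (auto simp: thompsonF_cellular thompsonF_fixes_outside)

lemma thompsonF_carries:
  assumes "h \<in> thompsonF"
  obtains S T where "carries h S 0 1 T 0 1"
  using assms cellular_carries[of h 0 0 0 1 0 0] cell_0_0
  by (metis thompsonF_iff fixes_outside_def)

lemma thompsonF_comp: "h \<in> thompsonF \<Longrightarrow> h' \<in> thompsonF \<Longrightarrow> h' \<circ> h \<in> thompsonF"
  unfolding thompsonF_iff by (auto simp: cellular_comp fixes_outside_def)

lemma thompsonF_id: "id \<in> thompsonF"
proof -
  have "carries id Leaf 0 1 Leaf 0 1" by (simp add: carries_def affine_on_def)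
  then show ?thesis by (rule carries_thompsonF) (simp add: fixes_outside_def)
qed

lemma carries_ends:
  assumes "carries h S a b T c d" "a < b" "c < d"
  shows "h a = c" "h b = d"
proof -
  have 1: "\<And>U x y. fst (hd (intervals U x y)) = x \<and> snd (last (intervals U x y)) = y"
  proof -
    fix U x y show "fst (hd (intervals U x y)) = x \<and> snd (last (intervals U x y)) = y"
    proof (induction U arbitrary: x y)
      case (Caret l r)
      have "intervals t u v \<noteq> []" for t u v by (metis length_intervals length_0_conv nleaves_neq_0)
      then show ?case using Caret by simp
    qed auto
  qed
  have n: "nleaves S = nleaves T" using carries_nleaves assms by blast
  have ne: "intervals U x y \<noteq> []" for U x y by (metis length_intervals length_0_conv nleaves_neq_0)
  have "affine_on h (intervals S a b ! i) (intervals T c d ! i)" if "i < nleaves S" for i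
    using that assms(1) by (auto simp: carries_def list_all2_conv_all_nth)
  from this[of 0] this[of "nleaves S - 1"]
  have "affine_on h (hd (intervals S a b)) (hd (intervals T c d))"
    "affine_on h (last (intervals S a b)) (last (intervals T c d))"
    using ne n by (simp_all add: hd_conv_nth last_conv_nth)
  moreover have "fst (hd (intervals S a b)) < snd (hd (intervals S a b))"
    "fst (last (intervals S a b)) < snd (last (intervals S a b))"
    using interval_less[OF assms(2), of 0 S] interval_less[OF assms(2), of "nleaves S - 1" S] ne
    by (simp_all add: hd_conv_nth last_conv_nth)
  ultimately show "h a = c" "h b = d"
    using affine_on_ends 1 by (metis prod.collapse)+
qed

lemma diagram_fun_thompsonF:
  assumes "carets S = carets T"
  shows "diagram_fun (S, T) \<in> thompsonF"
proof -
  note c = carries_diagram_fun[of S T, unfolded nleaves_carets, OF arg_cong[OF assms]]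
  show ?thesis
    using c(1)
  proof (rule carries_thompsonF)
    show "fixes_outside (diagram_fun (S, T))"
      using c(2) carries_ends[OF c(1)] by (auto simp: fixes_outside_def)
  qed
qed

text \<open>Exchanging the two trees of a diagram gives a two-sided inverse. Bijectivity is recorded
  because \<open>inv\<close> is defined by choice and is the group inverse only for
  bijections.\<close>

lemma thompsonF_inverse:
  assumes "h \<in> thompsonF"
  shows "bij h" "inv h \<in> thompsonF"
proof -
  obtain S T where c: "carries h S 0 1 T 0 1" using thompsonF_carries[OF assms] .
  have n: "nleaves S = nleaves T" using carries_nleaves[OF c] .
  define g where "g = diagram_fun (T, S)"
  have g: "carries g T 0 1 S 0 1" "\<And>x. x < 0 \<or> 1 < x \<Longrightarrow> g x = x" "g \<in> thompsonF"
    using carries_diagram_fun[OF n[symmetric]] diagram_fun_thompsonF[of T S] n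
    by (auto simp: g_def nleaves_carets)
  have out: "h x = x" if "x < 0 \<or> 1 < x" for x
    using assms that by (auto simp: thompsonF_def)
  have id: "carries id U 0 1 U 0 1" for U by (rule carries_affine) (auto simp: affine_on_def)
  have "g \<circ> h = id"
  proof
    fix x show "(g \<circ> h) x = id x"
      using carries_eq[OF carries_comp[OF c g(1)] id, of x] out[of x] g(2)[of x]
      by (cases "0 \<le> x \<and> x \<le> 1") auto
  qed
  moreover have "h \<circ> g = id"
  proof
    fix x show "(h \<circ> g) x = id x"
      using carries_eq[OF carries_comp[OF g(1) c] id, of x] out[of x] g(2)[of x]
      by (cases "0 \<le> x \<and> x \<le> 1") auto
  qed
  ultimately show "bij h" "inv h \<in> thompsonF"
    using o_bij[of g h] inv_unique_comp[of h g] g(3) by auto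
qed

subsection \<open>Generating pairs\<close>

lemma gen_subgroup_thompsonF:
  assumes "S \<subseteq> thompsonF" "h \<in> gen_subgroup S"
  shows "h \<in> thompsonF"
  using assms(2) by induction (use assms(1) thompsonF_id thompsonF_comp thompsonF_inverse(2) in blast)+

lemma gen_subgroup_comp:
  assumes "h \<in> gen_subgroup S" "h' \<in> gen_subgroup S"
  shows "h \<circ> h' \<in> gen_subgroup S"
  using assms(1)
proof induction
  case gen_id
  then show ?case using assms(2) by simp
next
  case (gen_mult u v)
  show ?case unfolding comp_assoc by (rule gen_subgroup.gen_mult[OF gen_mult(3,2)])
next
  case (gen_inv u v)
  show ?case unfolding comp_assoc by (rule gen_subgroup.gen_inv[OF gen_inv(3,2)])
qed

lemma gen_subgroup_base: "h \<in> S \<Longrightarrow> h \<in> gen_subgroup S"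
  using gen_subgroup.gen_mult[OF gen_subgroup.gen_id, of h S] by simp

lemma gen_subgroup_inverse:
  assumes "S \<subseteq> thompsonF" "h \<in> gen_subgroup S"
  shows "inv h \<in> gen_subgroup S"
  using assms(2)
proof induction
  case gen_id
  then show ?case by (simp only: inv_id gen_subgroup.gen_id)
next
  case (gen_mult u v)
  have b: "bij u" "bij v"
    using gen_mult gen_subgroup_thompsonF[OF assms(1)] thompsonF_inverse(1) assms(1) by blast+
  have "inv v \<in> gen_subgroup S"
    using gen_subgroup.gen_inv[OF gen_subgroup.gen_id gen_mult.hyps(2)] by simp
  then show ?case unfolding o_inv_distrib[OF b(2,1)] by (intro gen_subgroup_comp gen_mult.IH)
next
  case (gen_inv u v)
  have b: "bij u" "bij v"
    using gen_inv gen_subgroup_thompsonF[OF assms(1)] thompsonF_inverse(1) assms(1) by blast+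
  have eq: "inv (inv v \<circ> u) = inv u \<circ> v"
    using o_inv_distrib[OF bij_imp_bij_inv[OF b(2)] b(1)] b(2) by (simp add: inv_inv_eq)
  show ?case unfolding eq by (rule gen_subgroup_comp[OF gen_inv.IH gen_subgroup_base[OF gen_inv.hyps(2)]])
qed

lemma gen_subgroup_funpow: "h \<in> gen_subgroup S \<Longrightarrow> (h ^^ n) \<in> gen_subgroup S"
  by (induction n) (auto intro: gen_subgroup_comp gen_subgroup.gen_id simp: id_def[symmetric])

fun comb :: "nat \<Rightarrow> tree" where
  "comb 0 = Leaf"
| "comb (Suc n) = Caret Leaf (comb n)"

text \<open>Nothing is prescribed for \<open>f\<close> between 1/4 and 1/2, and only the lower bound
  \<open>g_ge\<close> for \<open>g\<close> between 5/8 and 3/4: these are the slots for the hidden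
  diagrams. \<open>S\<close> may contain further elements of F, which allows for the remaining
  entries of a tuple.\<close>

locale generating_pair =
  fixes f g :: "real \<Rightarrow> real" and S :: "(real \<Rightarrow> real) set"
  assumes S: "S \<subseteq> thompsonF" "f \<in> S" "g \<in> S"
    and f_left: "0 \<le> x \<Longrightarrow> x \<le> 1/4 \<Longrightarrow> f x = 2 * x"
    and f_mid: "1/2 \<le> x \<Longrightarrow> x \<le> 5/8 \<Longrightarrow> f x = x / 2 + 5/16"
    and f_right: "5/8 \<le> x \<Longrightarrow> f x = x"
    and g_left: "x \<le> 1/2 \<Longrightarrow> g x = x"
    and g_mid: "1/2 \<le> x \<Longrightarrow> x \<le> 5/8 \<Longrightarrow> g x = 2 * x - 1/2"
    and g_ge: "5/8 \<le> x \<Longrightarrow> 3/4 \<le> g x"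
    and g_right: "3/4 \<le> x \<Longrightarrow> x \<le> 1 \<Longrightarrow> g x = (1 + x) / 2"
begin

definition H :: "(real \<Rightarrow> real) set" where
  "H = gen_subgroup S"

lemma H_thompsonF: "h \<in> H \<Longrightarrow> h \<in> thompsonF"
  unfolding H_def by (rule gen_subgroup_thompsonF[OF S(1)])

lemma H_bij: "h \<in> H \<Longrightarrow> bij h"
  using H_thompsonF thompsonF_inverse(1) by blast

lemma H_closed: "id \<in> H" "f \<in> H" "g \<in> H"
  "h \<in> H \<Longrightarrow> h' \<in> H \<Longrightarrow> h \<circ> h' \<in> H" "h \<in> H \<Longrightarrow> inv h \<in> H" "h \<in> H \<Longrightarrow> (h ^^ n) \<in> H"
  unfolding H_def using S
  by (auto intro: gen_subgroup.gen_id gen_subgroup_base gen_subgroup_comp gen_subgroup_inverse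
      gen_subgroup_funpow)

lemma cancel [simp]: "h \<in> H \<Longrightarrow> inv h (h x) = x" "h \<in> H \<Longrightarrow> h (inv h x) = x"
  by (simp_all add: inv_f_f[OF bij_is_inj[OF H_bij]] surj_f_inv_f[OF bij_is_surj[OF H_bij]])

lemma inverseI: "h \<in> H \<Longrightarrow> h x = y \<Longrightarrow> inv h y = x"
  by auto

lemma f_inv: "0 \<le> x \<Longrightarrow> x \<le> 1/2 \<Longrightarrow> inv f x = x / 2"
  "9/16 \<le> x \<Longrightarrow> x \<le> 5/8 \<Longrightarrow> inv f x = 2 * x - 5/8"
  "5/8 \<le> x \<Longrightarrow> inv f x = x"
  using f_left[of "x / 2"] f_mid[of "2 * x - 5/8"] f_right[of x]
  by (intro inverseI H_closed; simp add: diff_divide_distrib)+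

lemma f_inv_le: "x \<le> 9/16 \<Longrightarrow> inv f x \<le> 1/2"
  using f_mid[of "inv f x"] f_right[of "inv f x"] H_closed(2) by (cases "inv f x \<le> 5/8") force+

lemma g_inv: "x \<le> 1/2 \<Longrightarrow> inv g x = x"
  "1/2 \<le> x \<Longrightarrow> x \<le> 3/4 \<Longrightarrow> inv g x = x / 2 + 1/4"
  using g_left[of x] g_mid[of "x / 2 + 1/4"]
  by (intro inverseI H_closed; simp add: algebra_simps)+

definition k0 :: "real \<Rightarrow> real" where
  "k0 = inv g \<circ> f \<circ> g \<circ> inv f"

lemma k0_H: "k0 \<in> H"
  unfolding k0_def by (intro H_closed)

text \<open>The points 9/16 and 19/32, which cut J in the shape A(BC), go to 17/32 and 9/16, which
  cut it in the shape (AB)C.\<close>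

lemma k0:
  "x \<le> 1/2 \<Longrightarrow> k0 x = x"
  "1/2 \<le> x \<Longrightarrow> x \<le> 9/16 \<Longrightarrow> k0 x = x / 2 + 1/4"
  "9/16 \<le> x \<Longrightarrow> x \<le> 19/32 \<Longrightarrow> k0 x = x - 1/32"
  "19/32 \<le> x \<Longrightarrow> x \<le> 5/8 \<Longrightarrow> k0 x = 2 * x - 5/8"
  "5/8 \<le> x \<Longrightarrow> k0 x = x"
proof -
  have low: "k0 x = inv g x" if "x \<le> 9/16" for x
    using g_left[OF f_inv_le[OF that]] H_closed(2) by (simp add: k0_def)
  show "x \<le> 1/2 \<Longrightarrow> k0 x = x" "1/2 \<le> x \<Longrightarrow> x \<le> 9/16 \<Longrightarrow> k0 x = x / 2 + 1/4"
    using low[of x] g_inv[of x] by auto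
  show "k0 x = x - 1/32" if "9/16 \<le> x" "x \<le> 19/32"
  proof -
    have "inv f x = 2 * x - 5/8" "g (2 * x - 5/8) = 4 * x - 7/4"
      "f (4 * x - 7/4) = 2 * x - 9/16" "inv g (2 * x - 9/16) = x - 1/32"
      using that by (simp_all add: f_inv g_mid f_mid g_inv diff_divide_distrib)
    then show ?thesis by (simp only: k0_def comp_apply)
  qed
  show "k0 x = 2 * x - 5/8" if "19/32 \<le> x" "x \<le> 5/8"
  proof -
    have "inv f x = 2 * x - 5/8" "g (2 * x - 5/8) = 4 * x - 7/4"
      "f (4 * x - 7/4) = 4 * x - 7/4" "inv g (4 * x - 7/4) = 2 * x - 5/8"
      using that by (simp_all add: f_inv g_mid f_right g_inv diff_divide_distrib)
    then show ?thesis by (simp only: k0_def comp_apply)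
  qed
  show "5/8 \<le> x \<Longrightarrow> k0 x = x"
    using f_inv(3)[of x] g_ge[of x] f_right[of "g x"] H_closed(3) by (simp add: k0_def)
qed

section \<open>The copy of F on J\<close>

definition supported :: "(real \<Rightarrow> real) \<Rightarrow> bool" where
  "supported h \<longleftrightarrow> (\<forall>x. x \<le> 1/2 \<or> 5/8 \<le> x \<longrightarrow> h x = x)"

text \<open>The element of F supported on J with diagram \<open>(T, U)\<close> belongs to
  \<open>H\<close>. This is an equivalence relation on trees, to be identified as equality of the
  number of carets.\<close>

definition reach :: "tree \<Rightarrow> tree \<Rightarrow> bool" where
  "reach T U \<longleftrightarrow> (\<exists>h\<in>H. supported h \<and> carries h T (1/2) (5/8) U (1/2) (5/8))"

lemma reach_refl: "reach T T"
  unfolding reach_def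
  by (rule bexI[OF _ H_closed(1)]) (auto simp: supported_def affine_on_def intro: carries_affine)

lemma reach_sym: "reach T U \<Longrightarrow> reach U T"
  unfolding reach_def
proof (elim bexE conjE)
  fix h assume h: "h \<in> H" "supported h" "carries h T (1/2) (5/8) U (1/2) (5/8)"
  have "supported (inv h)"
    using h(1,2) unfolding supported_def by (metis cancel(1))
  moreover have "carries (inv h) U (1/2) (5/8) T (1/2) (5/8)"
    using h by (intro carries_inverse[OF h(3)]) auto
  ultimately show "\<exists>h\<in>H. supported h \<and> carries h U (1/2) (5/8) T (1/2) (5/8)"
    using H_closed(5)[OF h(1)] by blast
qed

lemma reach_trans: "reach T U \<Longrightarrow> reach U V \<Longrightarrow> reach T V"
  unfolding reach_def
proof (elim bexE conjE)
  fix h h' assume h: "h \<in> H" "supported h" "carries h T (1/2) (5/8) U (1/2) (5/8)"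
    and h': "h' \<in> H" "supported h'" "carries h' U (1/2) (5/8) V (1/2) (5/8)"
  have "supported (h' \<circ> h)" using h(2) h'(2) by (simp add: supported_def)
  moreover have "carries (h' \<circ> h) T (1/2) (5/8) V (1/2) (5/8)"
    by (rule carries_comp[OF h(3) h'(3)]) auto
  ultimately show "\<exists>h\<in>H. supported h \<and> carries h T (1/2) (5/8) V (1/2) (5/8)"
    using H_closed(4)[OF h'(1) h(1)] by blast
qed

lemma reach_assoc: "reach (Caret A (Caret B C)) (Caret (Caret A B) C)"
proof -
  have "carries k0 A (1/2) (9/16) A (1/2) (17/32)"
    "carries k0 B (9/16) (19/32) B (17/32) (9/16)"
    "carries k0 C (19/32) (5/8) C (9/16) (5/8)"
    by (auto intro!: carries_affine simp: affine_on_def k0 field_simps)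
  then have "carries k0 (Caret A (Caret B C)) (1/2) (5/8) (Caret (Caret A B) C) (1/2) (5/8)"
    by (simp add: carries_def list_all2_appendI)
  moreover have "supported k0" using k0 by (auto simp: supported_def)
  ultimately show ?thesis using k0_H unfolding reach_def by blast
qed

text \<open>\<open>f\<close> maps J affinely onto its right half, so conjugation by \<open>f\<close>
  transplants the diagram there. The unknown part of \<open>f\<close> is harmless: up to 9/16 the
  inverse of \<open>f\<close> leads to points up to 1/2, which \<open>h\<close> fixes.\<close>

lemma reach_right:
  assumes "reach T U"
  shows "reach (Caret A T) (Caret A U)"
proof -
  obtain h where h: "h \<in> H" "supported h" "carries h T (1/2) (5/8) U (1/2) (5/8)"
    using assms unfolding reach_def by blast
  let ?h = "f \<circ> (h \<circ> inv f)"
  have "affine_on (inv f) (9/16, 5/8) (1/2, 5/8)" "affine_on f (1/2, 5/8) (9/16, 5/8)"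
    by (auto simp: affine_on_def f_inv(2) f_mid field_simps)
  then have "carries ?h T (9/16) (5/8) U (9/16) (5/8)"
    by (intro carries_comp[OF carries_comp[OF carries_affine h(3)] carries_affine]) auto
  moreover have low: "?h x = x" if "x \<le> 9/16" for x
    using f_inv_le[OF that] h(2) H_closed(2) by (simp add: supported_def)
  then have "carries ?h A (1/2) (9/16) A (1/2) (9/16)"
    by (intro carries_affine) (auto simp: affine_on_def)
  ultimately have "carries ?h (Caret A T) (1/2) (5/8) (Caret A U) (1/2) (5/8)"
    by (intro carries_Caret) simp_all
  moreover have "supported ?h"
    using low f_inv(3) f_right h(2) by (auto simp: supported_def)
  ultimately show ?thesis using h(1) unfolding reach_def by (blast intro: H_closed)
qed

text \<open>\<open>inv g\<close> maps J affinely onto its left half. From 9/16 on, \<open>g\<close>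
  leads to points from 5/8 on, which \<open>h\<close> fixes, so the unknown part of \<open>g\<close>
  cancels.\<close>

lemma reach_left:
  assumes "reach T U"
  shows "reach (Caret T A) (Caret U A)"
proof -
  obtain h where h: "h \<in> H" "supported h" "carries h T (1/2) (5/8) U (1/2) (5/8)"
    using assms unfolding reach_def by blast
  let ?h = "inv g \<circ> (h \<circ> g)"
  have "affine_on g (1/2, 9/16) (1/2, 5/8)" "affine_on (inv g) (1/2, 5/8) (1/2, 9/16)"
    using g_inv(2) g_mid by (auto simp: affine_on_def field_simps)
  then have "carries ?h T (1/2) (9/16) U (1/2) (9/16)"
    by (intro carries_comp[OF carries_comp[OF carries_affine h(3)] carries_affine]) auto
  moreover have high: "?h x = x" if "9/16 \<le> x" for x
  proof -
    have "5/8 \<le> g x" using g_mid[of x] g_ge[of x] that by (cases "x \<le> 5/8") auto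
    then show ?thesis using h(2) H_closed(3) by (simp add: supported_def)
  qed
  then have "carries ?h A (9/16) (5/8) A (9/16) (5/8)"
    by (intro carries_affine) (auto simp: affine_on_def)
  ultimately have "carries ?h (Caret T A) (1/2) (5/8) (Caret U A) (1/2) (5/8)"
    by (intro carries_Caret) simp_all
  moreover have "supported ?h"
    using high g_inv(1) g_left h(2) by (auto simp: supported_def)
  ultimately show ?thesis using h(1) unfolding reach_def by (blast intro: H_closed)
qed

text \<open>The right comb is the normal form under reassociation; reaching it from both trees
  connects any two trees of the same size.\<close>

lemma reach_comb: "reach T (comb (carets T))"
proof (induction T)
  case Leaf
  then show ?case by (simp add: reach_refl)
next
  case (Caret l r)
  have "reach (Caret (comb a) (comb b)) (comb (Suc (a + b)))" for a b
  proof (induction a)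
    case (Suc a)
    have "reach (Caret (comb (Suc a)) (comb b)) (Caret Leaf (Caret (comb a) (comb b)))"
      using reach_sym[OF reach_assoc] by simp
    moreover have "reach (Caret Leaf (Caret (comb a) (comb b))) (comb (Suc (Suc a + b)))"
      using reach_right[OF Suc.IH] by simp
    ultimately show ?case by (rule reach_trans)
  qed (simp add: reach_refl)
  then show ?case
    using reach_trans[OF reach_left[OF Caret.IH(1)] reach_trans[OF reach_right[OF Caret.IH(2)]]]
    by simp
qed

lemma supported_H:
  assumes "h \<in> thompsonF" "supported h"
  shows "h \<in> H"
proof -
  \<comment> \<open>J is a dyadic cell mapped onto itself, so \<open>h\<close> has a tree diagram
    over J alone.\<close>
  have J: "cell 3 4 = (1/2, 5/8)" by (simp add: cell_def)
  have ends: "h (1/2) = 1/2" "h (5/8) = 5/8" using assms(2) by (auto simp: supported_def)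
  have "cellular h" using assms(1) by (simp add: thompsonF_iff)
  from cellular_carries[OF this J, of 3 4, unfolded ends, OF J]
  obtain T U where c: "carries h T (1/2) (5/8) U (1/2) (5/8)" .
  then have "carets T = carets U" using carries_nleaves by (auto simp: nleaves_carets)
  then have "reach U (comb (carets T))" using reach_comb[of U] by simp
  then have "reach T U" by (rule reach_trans[OF reach_comb reach_sym])
  then obtain h' where h': "h' \<in> H" "supported h'" "carries h' T (1/2) (5/8) U (1/2) (5/8)"
    unfolding reach_def by blast
  have "h x = h' x" for x
    using carries_eq[OF c h'(3), of x] assms(2) h'(2)
    by (cases "x \<le> 1/2 \<or> 5/8 \<le> x") (auto simp: supported_def)
  then show ?thesis using h'(1) by (metis ext)
qed

section \<open>From J to compact supports and to the whole of F\<close>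

lemma f_inv_funpow: "0 \<le> x \<Longrightarrow> x \<le> 1/2 \<Longrightarrow> (inv f ^^ n) x = x / 2 ^ n"
proof (induction n)
  case (Suc n)
  have "x / 2 ^ n \<le> x" using Suc.prems(1) by (simp add: divide_le_eq mult_le_cancel_left1)
  then have "x / 2 ^ n \<le> 1/2" using Suc.prems by linarith
  then have "inv f (x / 2 ^ n) = x / 2 ^ n / 2" using Suc.prems(1) by (intro f_inv(1)) simp
  then show ?case using Suc by simp
qed simp

lemma f_funpow: "0 \<le> x \<Longrightarrow> x \<le> 1 / 2 ^ (n + 1) \<Longrightarrow> (f ^^ n) x = 2 ^ n * x"
proof (induction n)
  case (Suc n)
  have "2 ^ n * x \<le> 1/4" using Suc.prems(2) by (simp add: field_simps)
  then have "f (2 ^ n * x) = 2 * (2 ^ n * x)" using Suc.prems(1) by (intro f_left) auto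
  moreover have "x \<le> 1 / 2 ^ (n + 1)"
    using Suc.prems(2) by (rule order_trans) (simp add: field_simps)
  ultimately show ?case using Suc by simp
qed simp

lemma g_funpow: "0 \<le> t \<Longrightarrow> t \<le> 1/4 \<Longrightarrow> (g ^^ n) (1 - t) = 1 - t / 2 ^ n"
proof (induction n)
  case (Suc n)
  have "t / 2 ^ n \<le> t" using Suc.prems(1) by (simp add: divide_le_eq mult_le_cancel_left1)
  then have "3/4 \<le> 1 - t / 2 ^ n" using Suc.prems by linarith
  moreover have "0 \<le> t / 2 ^ n" using Suc.prems by simp
  ultimately have "g (1 - t / 2 ^ n) = (1 + (1 - t / 2 ^ n)) / 2" by (intro g_right) linarith+
  moreover have "(g ^^ Suc n) (1 - t) = g (1 - t / 2 ^ n)" using Suc by simp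
  ultimately show ?case by (simp add: field_simps)
qed simp

lemma g_inv_funpow: "0 \<le> t \<Longrightarrow> t \<le> 1 / 2 ^ (n + 2) \<Longrightarrow> (inv g ^^ n) (1 - t) = 1 - 2 ^ n * t"
proof (induction n)
  case (Suc n)
  have "2 * (2 ^ n * t) \<le> 1/4" using Suc.prems(2) by (simp add: field_simps)
  then have "g (1 - 2 * (2 ^ n * t)) = (1 + (1 - 2 * (2 ^ n * t))) / 2"
    using Suc.prems(1) by (intro g_right) auto
  then have "inv g (1 - 2 ^ n * t) = 1 - 2 * (2 ^ n * t)"
    by (intro inverseI H_closed) (simp add: field_simps)
  moreover have "t \<le> 1 / 2 ^ (n + 2)"
    using Suc.prems(2) by (rule order_trans) (simp add: field_simps)
  ultimately show ?case using Suc by simp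
qed simp

lemma f_inv_funpow_right: "5/8 \<le> x \<Longrightarrow> (inv f ^^ n) x = x" "5/8 \<le> x \<Longrightarrow> (f ^^ n) x = x"
  and g_funpow_left: "x \<le> 1/2 \<Longrightarrow> (g ^^ n) x = x" "x \<le> 1/2 \<Longrightarrow> (inv g ^^ n) x = x"
  by (induction n) (auto simp: f_inv f_right g_left g_inv)

lemma g_funpow_ge: "5/8 \<le> x \<Longrightarrow> 5/8 \<le> (g ^^ n) x \<and> 1 - 1 / 2 ^ (n + 1) \<le> (g ^^ n) x"
proof (induction n)
  case (Suc n)
  define y where "y = (g ^^ n) x"
  have y: "5/8 \<le> y" "1 - 1 / 2 ^ (n + 1) \<le> y" using Suc by (auto simp: y_def)
  have le1: "1 - 1 / 2 ^ m \<le> (1::real)" for m :: nat by simp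
  consider "y < 3/4" | "3/4 \<le> y" "y \<le> 1" | "1 < y" by linarith
  then have "1 - 1 / 2 ^ (Suc n + 1) \<le> g y"
  proof cases
    case 1
    \<comment> \<open>For positive \<open>n\<close> the induction hypothesis already gives at least
      3/4, so only the first application of \<open>g\<close> can start in the slot between 5/8 and
      3/4.\<close>
    have "n = 0"
    proof (rule ccontr)
      assume "n \<noteq> 0"
      then have "(2::real) ^ 2 \<le> 2 ^ (n + 1)" by (intro power_increasing) auto
      then have "1 / 2 ^ (n + 1) \<le> (1/4::real)" by (simp add: field_simps)
      then show False using 1 y by linarith
    qed
    then show ?thesis using g_ge[OF y(1)] by simp
  next
    case 2
    have "1 - 1 / 2 ^ (Suc n + 1) = (1 + (1 - 1 / 2 ^ (n + 1))) / (2::real)" by (simp add: field_simps)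
    also have "\<dots> \<le> (1 + y) / 2" by (intro divide_right_mono add_left_mono y(2)) simp
    finally show ?thesis by (simp only: g_right[OF 2])
  next
    case 3
    then have "g y = y" using H_thompsonF[OF H_closed(3)] thompsonF_fixes_outside fixes_outside_def by blast
    then show ?thesis using 3 le1[of "Suc n + 1"] by linarith
  qed
  then show ?case using g_ge[OF y(1)] by (simp add: y_def)
qed auto

text \<open>The element \<open>c\<close> stretches J over the support of \<open>h\<close>: powers of
  \<open>inv f\<close> push the left end towards 0 and fix everything from 5/8 on, powers of
  \<open>g\<close> push the right end towards 1 and fix everything up to 1/2. Hence
  \<open>inv c \<circ> h \<circ> c\<close> is supported on J.\<close>

lemma compact_support_H:
  assumes "h \<in> thompsonF" "\<And>x. x \<le> 1 / 2 ^ (m + 1) \<Longrightarrow> h x = x"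
    "\<And>x. 1 - 1 / 2 ^ (n + 1) \<le> x \<Longrightarrow> h x = x"
  shows "h \<in> H"
proof -
  define c where "c = (g ^^ n) \<circ> (inv f ^^ m)"
  have c: "c \<in> H" unfolding c_def by (intro H_closed)
  have "h (c x) = c x" if "x \<le> 1/2 \<or> 5/8 \<le> x" for x
    using that
  proof
    assume x: "x \<le> 1/2"
    have "(inv f ^^ m) x \<le> 1 / 2 ^ (m + 1)"
    proof (cases "0 \<le> x")
      case True
      then show ?thesis using x f_inv_funpow[OF True x] by (simp add: field_simps)
    next
      case False
      have "fixes_outside (inv f ^^ m)"
        using H_thompsonF[OF H_closed(6)[OF H_closed(5)[OF H_closed(2)]]] thompsonF_fixes_outside by blast
      then have "(inv f ^^ m) x = x" using False by (simp add: fixes_outside_def)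
      then show ?thesis using False by (simp add: order_trans[of x 0])
    qed
    moreover have "1 / 2 ^ (m + 1) \<le> (1/2 :: real)" by (simp add: field_simps)
    ultimately have le: "(inv f ^^ m) x \<le> 1 / 2 ^ (m + 1)" "(inv f ^^ m) x \<le> 1/2" by linarith+
    have "c x = (inv f ^^ m) x" using g_funpow_left(1)[OF le(2)] by (simp add: c_def)
    then show ?thesis using assms(2)[OF le(1)] by simp
  next
    assume "5/8 \<le> x"
    then show ?thesis using assms(3) f_inv_funpow_right(1)[of x m] g_funpow_ge[of x n] by (simp add: c_def)
  qed
  then have "supported (inv c \<circ> h \<circ> c)" using c by (simp add: supported_def)
  moreover have "inv c \<circ> h \<circ> c \<in> thompsonF"
    using assms(1) H_thompsonF[OF c] thompsonF_inverse(2) by (intro thompsonF_comp) auto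
  ultimately have "inv c \<circ> h \<circ> c \<in> H" by (intro supported_H)
  then have "c \<circ> (inv c \<circ> h \<circ> c) \<circ> inv c \<in> H"
    by (rule H_closed(4)[OF H_closed(4)[OF c] H_closed(5)[OF c]])
  moreover have eq: "c \<circ> (inv c \<circ> h \<circ> c) \<circ> inv c = h" using c by (auto simp: fun_eq_iff)
  ultimately show ?thesis by (simp only: eq)
qed

text \<open>A fine cell at a fixed endpoint of [0, 1] is mapped affinely to a cell with the same
  endpoint, so the slope there is the quotient of the two lengths. Levels of at least 2 put both
  cells within distance 1/4 of the endpoint, where the powers of \<open>f\<close> and
  \<open>g\<close> are known.\<close>

lemma cellular_fixed_ends:
  assumes "h \<in> thompsonF"
  obtains N N' where "2 \<le> N" "2 \<le> N'"
    "\<And>t. 0 \<le> t \<Longrightarrow> t \<le> 1 / 2 ^ N \<Longrightarrow> h t = 2 ^ N / 2 ^ N' * t"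
  and "\<exists>M M'. 2 \<le> M \<and> 2 \<le> M' \<and> (\<forall>t. 0 \<le> t \<and> t \<le> 1 / 2 ^ M \<longrightarrow> h (1 - t) = 1 - 2 ^ M / 2 ^ M' * t)"
proof -
  have h: "cellular h" "h 0 = 0" "h 1 = 1" using assms by (auto simp: thompsonF_iff fixes_outside_def)
  obtain N0 where N0: "\<And>N j. N0 \<le> N \<Longrightarrow> \<exists>N'\<ge>2. \<exists>j'. affine_on h (cell N j) (cell N' j')"
    using h(1) unfolding cellular_def by meson
  define N where "N = max N0 2"
  have N: "N0 \<le> N" "2 \<le> N" by (auto simp: N_def)
  obtain N' j' where N': "2 \<le> N'" "affine_on h (cell N 0) (cell N' j')" using N0[OF N(1)] by blast
  have "fst (cell N' j') = 0"
    using affine_on_ends(1)[of h "fst (cell N 0)" "snd (cell N 0)" "fst (cell N' j')" "snd (cell N' j')"]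
      N'(2) cell_less[of N 0] h(2) by (simp add: cell_def)
  then have "j' = 0" by (simp add: cell_def)
  then have 0: "h t = 2 ^ N / 2 ^ N' * t" if "0 \<le> t" "t \<le> 1 / 2 ^ N" for t
    using N'(2) that by (auto simp: affine_on_def cell_def)
  obtain M' i' where M': "2 \<le> M'" "affine_on h (cell N (2 ^ N - 1)) (cell M' i')" using N0[OF N(1)] by blast
  have "h (snd (cell N (2 ^ N - 1))) = snd (cell M' i')"
    using affine_on_ends(2)[OF _ cell_less, of h N "2 ^ N - 1" "fst (cell M' i')" "snd (cell M' i')"] M'(2)
    by simp
  moreover have "snd (cell N (2 ^ N - 1)) = 1" by (simp add: cell_def)
  ultimately have "snd (cell M' i') = 1" using h(3) by simp
  then have "(of_int i' + 1) / 2 ^ M' = (1::real)" unfolding cell_def snd_conv .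
  then have "of_int i' + 1 = (2 ^ M' :: real)" by (rule iffD1[OF right_inverse_eq, rotated]) simp
  then have i: "of_int i' = (2 ^ M' - 1 :: real)" by linarith
  have "h (1 - t) = 1 - 2 ^ N / 2 ^ M' * t" if "0 \<le> t" "t \<le> 1 / 2 ^ N" for t
  proof -
    have "cell N (2 ^ N - 1) = (1 - 1 / 2 ^ N, 1)" "cell M' i' = (1 - 1 / 2 ^ M', 1)"
      by (simp_all add: cell_def i diff_divide_distrib)
    then have "affine_on h (1 - 1 / 2 ^ N, 1) (1 - 1 / 2 ^ M', 1)" using M'(2) by simp
    then have "h (1 - t) = (1 - 1 / 2 ^ M') +
        (1 - (1 - 1 / 2 ^ M')) / (1 - (1 - 1 / 2 ^ N)) * ((1 - t) - (1 - 1 / 2 ^ N))"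
      by (rule affine_onD) (use that in linarith)+
    also have "\<dots> = 1 - 1 / 2 ^ M' + 2 ^ N / 2 ^ M' * (1 / 2 ^ N - t)" by simp
    also have "\<dots> = 1 - 2 ^ N / 2 ^ M' * t" by (simp add: right_diff_distrib)
    finally show ?thesis .
  qed
  then show ?thesis using that[OF N(2) N'(1) 0] N(2) M'(1) by blast
qed

lemma fix_near_0:
  assumes "h \<in> thompsonF"
  obtains u d where "u \<in> H" "0 < d" "\<And>x. 0 \<le> x \<Longrightarrow> x \<le> d \<Longrightarrow> u (h x) = x"
proof -
  obtain N N' where N: "2 \<le> N" "2 \<le> N'"
    and h: "\<And>t. 0 \<le> t \<Longrightarrow> t \<le> 1 / 2 ^ N \<Longrightarrow> h t = 2 ^ N / 2 ^ N' * t"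
    using cellular_fixed_ends[OF assms] by metis
  show ?thesis
  proof (cases "N \<le> N'")
    case True
    define n where "n = N' - N"
    have pw: "(2::real) ^ N' = 2 ^ N * 2 ^ n" using True by (simp add: n_def flip: power_add)
    have "(f ^^ n) (h t) = t" if t: "0 \<le> t" "t \<le> 1 / 2 ^ N" for t
    proof -
      have "h t = t / 2 ^ n" using h[OF t] by (simp add: pw)
      moreover have "1 / 2 ^ N \<le> (1 / 2 ^ 1 :: real)" using N by (intro divide_left_mono power_increasing) auto
      then have "t \<le> 1 / 2 ^ 1" by (rule order_trans[OF t(2)])
      then have "t / 2 ^ n \<le> 1 / 2 ^ (n + 1)" by (simp add: field_simps)
      ultimately show ?thesis using f_funpow[of "t / 2 ^ n" n] t by simp
    qed
    then show ?thesis using that[of "f ^^ n" "1 / 2 ^ N"] by (simp add: H_closed)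
  next
    case False
    define n where "n = N - N'"
    have pw: "(2::real) ^ N = 2 ^ N' * 2 ^ n" using False by (simp add: n_def flip: power_add)
    have "(inv f ^^ n) (h t) = t" if t: "0 \<le> t" "t \<le> 1 / 2 ^ N" for t
    proof -
      have "h t = 2 ^ n * t" using h[OF t] by (simp add: pw)
      moreover have "2 ^ n * t \<le> 1 / 2 ^ N'" using t by (simp add: pw field_simps)
      moreover from this have "2 ^ n * t \<le> 1 / 2 ^ 1"
        by (rule order_trans) (use N in \<open>intro divide_left_mono power_increasing; auto\<close>)
      ultimately show ?thesis using f_inv_funpow[of "2 ^ n * t" n] t by simp
    qed
    then show ?thesis using that[of "inv f ^^ n" "1 / 2 ^ N"] by (simp add: H_closed)
  qed
qed

text \<open>The corrector is a power of \<open>g\<close> or of \<open>inv g\<close>, so it fixes all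
  points up to 1/2. Thus correcting the slope at 1 does not disturb an earlier correction near
  0.\<close>

lemma fix_near_1:
  assumes "h \<in> thompsonF"
  obtains u d where "u \<in> H" "0 < d" "\<And>t. 0 \<le> t \<Longrightarrow> t \<le> d \<Longrightarrow> u (h (1 - t)) = 1 - t"
    "\<And>x. x \<le> 1/2 \<Longrightarrow> u x = x"
proof -
  obtain N N' where N: "2 \<le> N" "2 \<le> N'"
    and h: "\<And>t. 0 \<le> t \<Longrightarrow> t \<le> 1 / 2 ^ N \<Longrightarrow> h (1 - t) = 1 - 2 ^ N / 2 ^ N' * t"
    using cellular_fixed_ends[OF assms] by metis
  show ?thesis
  proof (cases "N \<le> N'")
    case True
    define n where "n = N' - N"
    have pw: "(2::real) ^ N' = 2 ^ N * 2 ^ n" using True by (simp add: n_def flip: power_add)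
    have "(inv g ^^ n) (h (1 - t)) = 1 - t" if t: "0 \<le> t" "t \<le> 1 / 2 ^ N" for t
    proof -
      have "h (1 - t) = 1 - t / 2 ^ n" using h[OF t] by (simp add: pw)
      moreover have "1 / 2 ^ N \<le> (1 / 2 ^ 2 :: real)" using N by (intro divide_left_mono power_increasing) auto
      then have "t \<le> 1 / 2 ^ 2" by (rule order_trans[OF t(2)])
      then have "t / 2 ^ n \<le> 1 / 2 ^ (n + 2)" by (simp add: field_simps)
      ultimately show ?thesis using g_inv_funpow[of "t / 2 ^ n" n] t by simp
    qed
    then show ?thesis using that[of "inv g ^^ n" "1 / 2 ^ N"] g_funpow_left by (simp add: H_closed)
  next
    case False
    define n where "n = N - N'"
    have pw: "(2::real) ^ N = 2 ^ N' * 2 ^ n" using False by (simp add: n_def flip: power_add)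
    have "(g ^^ n) (h (1 - t)) = 1 - t" if t: "0 \<le> t" "t \<le> 1 / 2 ^ N" for t
    proof -
      have "h (1 - t) = 1 - 2 ^ n * t" using h[OF t] by (simp add: pw)
      moreover have "2 ^ n * t \<le> 1 / 2 ^ N'" using t by (simp add: pw field_simps)
      moreover from this have "2 ^ n * t \<le> 1 / 2 ^ 2"
        by (rule order_trans) (use N in \<open>intro divide_left_mono power_increasing; auto\<close>)
      ultimately show ?thesis using g_funpow[of "2 ^ n * t" n] t by simp
    qed
    then show ?thesis using that[of "g ^^ n" "1 / 2 ^ N"] g_funpow_left by (simp add: H_closed)
  qed
qed

lemma gen_subgroup_eq: "gen_subgroup S = thompsonF"
proof
  show "gen_subgroup S \<subseteq> thompsonF" using H_thompsonF by (auto simp: H_def)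
  show "thompsonF \<subseteq> gen_subgroup S"
  proof
    fix h assume h: "h \<in> thompsonF"
    obtain u d where u: "u \<in> H" "0 < d" "\<And>x. 0 \<le> x \<Longrightarrow> x \<le> d \<Longrightarrow> u (h x) = x"
      using fix_near_0[OF h] by blast
    have uh: "u \<circ> h \<in> thompsonF" using thompsonF_comp[OF h H_thompsonF[OF u(1)]] .
    obtain v e where v: "v \<in> H" "0 < e" "\<And>t. 0 \<le> t \<Longrightarrow> t \<le> e \<Longrightarrow> v ((u \<circ> h) (1 - t)) = 1 - t"
      "\<And>x. x \<le> 1/2 \<Longrightarrow> v x = x"
      using fix_near_1[OF uh] by blast
    let ?w = "v \<circ> (u \<circ> h)"
    have w: "?w \<in> thompsonF" using thompsonF_comp[OF uh H_thompsonF[OF v(1)]] .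
    then have out: "?w x = x" if "x < 0 \<or> 1 < x" for x
      using that thompsonF_fixes_outside fixes_outside_def by blast
    obtain m where m: "(1/2) ^ m < d" using real_arch_pow_inv[OF u(2), of "1/2"] by auto
    obtain n where n: "(1/2) ^ n < e" using real_arch_pow_inv[OF v(2), of "1/2"] by auto
    have half: "1 / 2 ^ (i + 1) \<le> (1/2 :: real) ^ i" "1 / 2 ^ (i + 1) \<le> (1/2 :: real)" for i :: nat
      by (simp_all add: power_divide field_simps)
    have "?w x = x" if "x \<le> 1 / 2 ^ (m + 1)" for x
    proof (cases "x < 0")
      case False
      then have "u (h x) = x" using that m half(1)[of m] by (intro u(3)) auto
      moreover have "x \<le> 1/2" using that half(2)[of m] by linarith
      ultimately show ?thesis using v(4) by simp
    qed (use out in blast)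
    moreover have "?w x = x" if "1 - 1 / 2 ^ (n + 1) \<le> x" for x
    proof (cases "1 < x")
      case False
      then have "v ((u \<circ> h) (1 - (1 - x))) = 1 - (1 - x)"
        using that n half(1)[of n] by (intro v(3)) auto
      then show ?thesis by simp
    qed (use out in blast)
    ultimately have "?w \<in> H" using compact_support_H[OF w] by blast
    then have "inv u \<circ> (inv v \<circ> ?w) \<in> H"
      by (rule H_closed(4)[OF H_closed(5)[OF u(1)] H_closed(4)[OF H_closed(5)[OF v(1)]]])
    moreover have "inv u \<circ> (inv v \<circ> ?w) = h" using u(1) v(1) by (simp add: fun_eq_iff)
    ultimately show "h \<in> gen_subgroup S" by (simp add: H_def)
  qed
qed

end

subsection \<open>Diagrams containing an arbitrary diagram\<close>

text \<open>Realises the data for \<open>f\<close>: the leaves [0, 1/4] and J go to [0, 1/2] and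
  [9/16, 5/8], the last two leaves [5/8, 3/4] and [3/4, 1] go to themselves, and \<open>d\<close>
  fills the slot from [1/4, 1/2] to [1/2, 9/16].\<close>

definition graft_left :: "diagram \<Rightarrow> diagram" where
  "graft_left d = (Caret (Caret Leaf (fst d)) (Caret (Caret Leaf Leaf) Leaf),
     Caret Leaf (Caret (Caret (Caret (snd d) Leaf) Leaf) Leaf))"

text \<open>Realises the data for \<open>g\<close>: [0, 1/2] goes to itself, J to [1/2, 3/4],
  [3/4, 1] to [7/8, 1], and \<open>d\<close> fills the slot from [5/8, 3/4] to [3/4, 7/8].\<close>

definition graft_right :: "diagram \<Rightarrow> diagram" where
  "graft_right d = (Caret Leaf (Caret (Caret Leaf (fst d)) Leaf),
     Caret Leaf (Caret Leaf (Caret (snd d) Leaf)))"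

text \<open>Both trees of a graft hold \<open>d\<close> at the same leaf offset, 1 or 2
  respectively, so its exposed carets stay disjoint. If \<open>d\<close> is trivial, the carets
  around the slot become exposed, but at different positions: 0 against 1 on the left, 1 against 2
  on the right.\<close>

lemma graft_Xdiag:
  assumes "d \<in> Xdiag"
  shows "graft_left d \<in> Xdiag" "graft_right d \<in> Xdiag"
proof -
  obtain s t where d: "d = (s, t)" by (cases d)
  have c: "carets s = carets t" "exposed s 0 \<inter> exposed t 0 = {}"
    using assms by (auto simp: d Xdiag_def reduced_def)
  have L: "s = Leaf \<longleftrightarrow> t = Leaf" using c(1) by (cases s; cases t) auto
  have disj: "exposed s (0 + m) \<inter> exposed t (0 + m) = {}" for m
    using c(2) unfolding exposed_shift by auto
  \<comment> \<open>The one further exposed caret of the left graft, with leaves [1/2, 5/8] and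
    [5/8, 3/4] in the domain tree, starts just after the leaves of \<open>d\<close>.\<close>
  have "j \<noteq> Suc (nleaves s)" if "j \<in> exposed t 1" for j
    using exposed_bounds[OF that] c(1) by (simp add: nleaves_carets)
  then show "graft_left d \<in> Xdiag"
    using c(1) L disj[of 1] by (auto simp: d graft_left_def Xdiag_def reduced_def)
  show "graft_right d \<in> Xdiag"
    using c(1) L disj[of 2] by (auto simp: d graft_right_def Xdiag_def reduced_def numeral_2_eq_2)
qed

lemma dsize_graft:
  "dsize (graft_left d) = dsize d + 4" "dsize (graft_right d) = dsize d + 3"
  by (auto simp: dsize_def graft_left_def graft_right_def)

lemma inj_graft_left_right: "inj graft_left" "inj graft_right"
  by (auto simp: inj_def graft_left_def graft_right_def)

lemma graft_generating_pair:
  assumes d: "d \<in> Xdiag" "e \<in> Xdiag"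
    and S: "S \<subseteq> thompsonF" "diagram_fun (graft_left d) \<in> S" "diagram_fun (graft_right e) \<in> S"
  shows "generating_pair (diagram_fun (graft_left d)) (diagram_fun (graft_right e)) S"
proof -
  obtain s t where st: "d = (s, t)" by (cases d)
  obtain u v where uv: "e = (u, v)" by (cases e)
  have n: "nleaves s = nleaves t" "nleaves u = nleaves v"
    using d by (auto simp: st uv Xdiag_def reduced_def nleaves_carets)
  let ?f = "diagram_fun (graft_left d)" and ?g = "diagram_fun (graft_right e)"
  have "carries ?f (fst (graft_left d)) 0 1 (snd (graft_left d)) 0 1"
    using carries_diagram_fun(1)[of "fst (graft_left d)" "snd (graft_left d)"] n
    by (simp add: graft_left_def st)
  then have f: "affine_on ?f (0, 1/4) (0, 1/2)" "affine_on ?f (1/2, 5/8) (9/16, 5/8)"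
    "affine_on ?f (5/8, 3/4) (5/8, 3/4)" "affine_on ?f (3/4, 1) (3/4, 1)"
    using n by (simp_all add: graft_left_def st carries_def list_all2_append)
  have "carries ?g (fst (graft_right e)) 0 1 (snd (graft_right e)) 0 1"
    using carries_diagram_fun(1)[of "fst (graft_right e)" "snd (graft_right e)"] n
    by (simp add: graft_right_def uv)
  then have g: "affine_on ?g (0, 1/2) (0, 1/2)" "affine_on ?g (1/2, 5/8) (1/2, 3/4)"
    "carries ?g u (5/8) (3/4) v (3/4) (7/8)" "affine_on ?g (3/4, 1) (7/8, 1)"
    using n by (simp_all add: graft_right_def uv carries_def list_all2_append)
  have out: "?f x = x" "?g x = x" if "x < 0 \<or> 1 < x" for x
    using that S thompsonF_fixes_outside unfolding fixes_outside_def by blast+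
  show ?thesis
  proof
    show "?f x = 2 * x" if "0 \<le> x" "x \<le> 1/4" for x
      using affine_onD[OF f(1)] that by simp
    show "?f x = x / 2 + 5/16" if "1/2 \<le> x" "x \<le> 5/8" for x
      using affine_onD[OF f(2)] that by (simp add: field_simps)
    show "?f x = x" if "5/8 \<le> x" for x
      using affine_onD[OF f(3), of x] affine_onD[OF f(4), of x] out(1)[of x] that
      by (cases "x \<le> 3/4"; cases "x \<le> 1") auto
    show "?g x = x" if "x \<le> 1/2" for x
      using affine_onD[OF g(1), of x] out(2)[of x] that by (cases "0 \<le> x") auto
    show "?g x = 2 * x - 1/2" if "1/2 \<le> x" "x \<le> 5/8" for x
      using affine_onD[OF g(2)] that by (simp add: field_simps)
    show "?g x = (1 + x) / 2" if "3/4 \<le> x" "x \<le> 1" for x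
      using affine_onD[OF g(4) that] by (simp add: field_simps)
    show "3/4 \<le> ?g x" if "5/8 \<le> x" for x
    proof -
      consider "x \<le> 3/4" | "3/4 \<le> x" "x \<le> 1" | "1 < x" by linarith
      then show ?thesis
      proof cases
        case 1
        then show ?thesis using carries_bounds(1)[OF g(3)] that by simp
      next
        case 2
        then show ?thesis using affine_on_bounds(1)[OF g(4), of x] by simp
      next
        case 3
        then show ?thesis using out(2)[of x] by simp
      qed
    qed
  qed (use S in auto)
qed

lemma graft_generating_tuples:
  assumes "d \<in> Xdiag" "e \<in> Xdiag" "set ys \<subseteq> Xdiag" "length ys = k"
  shows "mset (graft_left d # graft_right e # ys) \<in> generating_tuples (k + 2)"
proof -
  let ?M = "mset (graft_left d # graft_right e # ys)"
  have M: "set_mset ?M \<subseteq> Xdiag" using assms graft_Xdiag by auto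
  have "diagram_fun c \<in> thompsonF" if "c \<in> Xdiag" for c
    using that diagram_fun_thompsonF[of "fst c" "snd c"] by (simp add: Xdiag_def reduced_def)
  then have "diagram_fun ` set_mset ?M \<subseteq> thompsonF" using M by blast
  then have "generating_pair (diagram_fun (graft_left d)) (diagram_fun (graft_right e))
      (diagram_fun ` set_mset ?M)"
    by (intro graft_generating_pair assms(1,2)) auto
  then have "gen_subgroup (diagram_fun ` set_mset ?M) = thompsonF"
    by (rule generating_pair.gen_subgroup_eq)
  then show ?thesis using M assms(4) by (simp add: generating_tuples_def Xk_def)
qed

interpretation graft: grafting graft_left graft_right
  by unfold_locales (auto simp: graft_Xdiag dsize_graft inj_graft_left_right)

theorem theorem1:
  fixes k :: nat
  assumes "k \<ge> 2"
  shows "positive_density sum_norm k (generating_tuples k) \<and>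
         positive_density max_norm k (generating_tuples k)"
proof -
  obtain j where k: "k = j + 2" using assms by (metis add.commute le_Suc_ex)
  show ?thesis
    unfolding k
    by (intro conjI graft.positive_density_sum_norm graft.positive_density_max_norm graft_generating_tuples)
qed

end
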